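(* Let $n\in\mathbb{N}$, $\mathbb{A} = (A_1,\dots,A_n)\in\mathbb{P}^n$ and $\omega=(w_1,\dots,w_n)\in\Delta_n$. For $0\le p\le q\le 1$, each of the following consecutive relations holds: $$\mathcal{H}(\omega;\mathbb{A}) \preceq Q_{-q}(\omega;\mathbb{A}) \preceq Q_{-p}(\omega;\mathbb{A}) \preceq \mathrm{LE}(\omega;\mathbb{A}) \preceq Q_p(\omega;\mathbb{A}) \preceq Q_q(\omega;\mathbb{A}) \preceq \mathcal{A}(\omega;\mathbb{A}).$$
   Context: $\mathbb{P}$ is the open convex cone of positive definite (positive and invertible) bounded linear operators on a Hilbert space. The Loewner order $X \le Y$ on self-adjoint operators means $Y - X$ is positive semi-definite. The metric geometric mean is $A \# B = A^{1/2}(A^{-1/2} B A^{-1/2})^{1/2}A^{1/2}$ for $A,B\in\mathbb{P}$. The near-order on $\mathbb{P}$ is defined by: $A \preceq B$ if and only if $A^{-1}\# B \ge I$. $\Delta_n$ is the set of probability vectors in $\mathbb{R}^n$ with all entries positive. For $p \in \mathbb{R}\setminus\{0\}$ the quasi-arithmetic mean of order $p$ is $Q_p(\omega;\mathbb{A}) = \left(\sum_{j=1}^n w_j A_j^p\right)^{1/p}$. The arithmetic, harmonic and log-Euclidean means are $\mathcal{A}(\omega;\mathbb{A}) = \sum_{j=1}^n w_jA_j$, $\mathcal{H}(\omega;\mathbb{A}) = \left(\sum_{j=1}^n w_jA_j^{-1}\right)^{-1}$ and $\mathrm{LE}(\omega;\mathbb{A}) = \exp\left(\sum_{j=1}^n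 w_j\log A_j\right)$. By convention $Q_0(\omega;\mathbb{A}) := \lim_{p\to0}Q_p(\omega;\mathbb{A}) = \mathrm{LE}(\omega;\mathbb{A})$. *)

theory Defs
  imports "HOL-Analysis.Analysis" "HOL-Computational_Algebra.Polynomial"
begin

text \<open>
  Complex Hilbert spaces.  The class sits on top of the real classes so that the library's norm,
  topology and bounded linear functions are available: scalar multiplication by complex numbers
  extends the real one, and the underlying real inner product is the real part of the complex one.
  Hence \<open>cinner x x = (norm x)\<^sup>2\<close> (proved below).  The sesquilinear form is antilinear in the
  first argument.
\<close>

class complex_hilbert = real_inner + complete_space +
  fixes scaleC :: "complex \<Rightarrow> 'a \<Rightarrow> 'a"  (infixr \<open>*\<^sub>C\<close> 75)
    and cinner :: "'a \<Rightarrow> 'a \<Rightarrow> complex"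
  assumes scaleC_add_right: "a *\<^sub>C (x + y) = a *\<^sub>C x + a *\<^sub>C y"
    and scaleC_add_left: "(a + b) *\<^sub>C x = a *\<^sub>C x + b *\<^sub>C x"
    and scaleC_scaleC: "a *\<^sub>C (b *\<^sub>C x) = (a * b) *\<^sub>C x"
    and scaleC_complex_of_real: "complex_of_real r *\<^sub>C x = r *\<^sub>R x"
    and cinner_commute: "cinner x y = cnj (cinner y x)"
    and cinner_add_left: "cinner (x + y) z = cinner x z + cinner y z"
    and cinner_scaleC_left: "cinner (a *\<^sub>C x) y = cnj a * cinner x y"
    and inner_eq_Re_cinner: "inner x y = Re (cinner x y)"

lemma cinner_self:
  fixes x :: "'a::complex_hilbert"
  shows "cinner x x = complex_of_real ((norm x)\<^sup>2)"
proof -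
  have "Im (cinner x x) = 0"
    using cinner_commute[of x x] by (simp add: complex_eq_iff)
  then show ?thesis
    by (simp add: complex_eq_iff power2_norm_eq_inner inner_eq_Re_cinner)
qed

lemma cinner_scaleC_right:
  fixes x :: "'a::complex_hilbert"
  shows "cinner x (a *\<^sub>C y) = a * cinner x y"
  by (metis cinner_commute cinner_scaleC_left complex_cnj_cnj complex_cnj_mult)

lemma norm_scaleC:
  fixes x :: "'a::complex_hilbert"
  shows "norm (a *\<^sub>C x) = cmod a * norm x"
proof -
  have "complex_of_real ((norm (a *\<^sub>C x))\<^sup>2) = complex_of_real ((cmod a * norm x)\<^sup>2)"
    unfolding cinner_self[symmetric] cinner_scaleC_left cinner_scaleC_right
    by (simp add: cinner_self power_mult_distrib mult_ac)
      (metis complex_norm_square mult.commute of_real_power)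
  then show ?thesis
    by (metis (no_types) mult_nonneg_nonneg norm_ge_zero of_real_eq_iff power2_eq_imp_eq)
qed

lemma bounded_linear_scaleC: "bounded_linear (\<lambda>x::'a::complex_hilbert. a *\<^sub>C x)"
proof
  fix x y :: 'a and r :: real
  show "a *\<^sub>C (x + y) = a *\<^sub>C x + a *\<^sub>C y"
    by (rule scaleC_add_right)
  show "a *\<^sub>C (r *\<^sub>R x) = r *\<^sub>R (a *\<^sub>C x)"
    by (simp add: scaleC_complex_of_real[symmetric] scaleC_scaleC mult.commute)
  show "\<exists>K. \<forall>x::'a. norm (a *\<^sub>C x) \<le> norm x * K"
    by (rule exI[of _ "cmod a"]) (simp add: norm_scaleC mult.commute)
qed

text \<open>The spaces \<open>\<complex>\<close> and \<open>\<complex>\<^sup>n\<close> are instances.\<close>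

instantiation complex :: complex_hilbert
begin
definition scaleC_complex :: "complex \<Rightarrow> complex \<Rightarrow> complex" where
  "scaleC_complex a x = a * x"
definition cinner_complex :: "complex \<Rightarrow> complex \<Rightarrow> complex" where
  "cinner_complex x y = cnj x * y"
instance
  by standard
    (simp_all add: scaleC_complex_def cinner_complex_def algebra_simps scaleR_conv_of_real
      inner_complex_def)
end

instantiation vec :: (complex_hilbert, finite) complex_hilbert
begin
definition scaleC_vec :: "complex \<Rightarrow> 'a ^ 'b \<Rightarrow> 'a ^ 'b" where
  "scaleC_vec a x = (\<chi> i. a *\<^sub>C (x $ i))"
definition cinner_vec :: "'a ^ 'b \<Rightarrow> 'a ^ 'b \<Rightarrow> complex" where
  "cinner_vec x y = (\<Sum>i\<in>UNIV. cinner (x $ i) (y $ i))"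
instance
proof
  fix x y :: "'a ^ 'b"
  show "cinner x y = cnj (cinner y x)"
    unfolding cinner_vec_def cnj_sum by (rule sum.cong[OF refl]) (rule cinner_commute)
qed (simp_all add: scaleC_vec_def cinner_vec_def vec_eq_iff scaleC_add_right scaleC_add_left
      scaleC_scaleC scaleC_complex_of_real cinner_add_left cinner_scaleC_left sum.distrib
      sum_distrib_left inner_vec_def inner_eq_Re_cinner)
end


text \<open>
  Bounded operators on a complex Hilbert space: the library type of bounded functions is only
  real linear, so complex linearity is imposed by \<open>bounded_ops\<close>.
\<close>

definition bounded_ops :: "('a::complex_hilbert \<Rightarrow>\<^sub>L 'a) set" where
  "bounded_ops = {T. \<forall>c x. blinfun_apply T (c *\<^sub>C x) = c *\<^sub>C blinfun_apply T x}"

lift_definition scalar_op :: "complex \<Rightarrow> ('a::complex_hilbert \<Rightarrow>\<^sub>L 'a)" is "\<lambda>a x. a *\<^sub>C x"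
  by (rule bounded_linear_scaleC)

definition inverse_ops :: "('a::complex_hilbert \<Rightarrow>\<^sub>L 'a) \<Rightarrow> ('a \<Rightarrow>\<^sub>L 'a) \<Rightarrow> bool" where
  "inverse_ops T S \<longleftrightarrow> S \<in> bounded_ops \<and> S o\<^sub>L T = id_blinfun \<and> T o\<^sub>L S = id_blinfun"

definition invertible_op :: "('a::complex_hilbert \<Rightarrow>\<^sub>L 'a) \<Rightarrow> bool" where
  "invertible_op T \<longleftrightarrow> (\<exists>S. inverse_ops T S)"

definition op_inverse :: "('a::complex_hilbert \<Rightarrow>\<^sub>L 'a) \<Rightarrow> ('a \<Rightarrow>\<^sub>L 'a)" where
  "op_inverse T = (THE S. inverse_ops T S)"

definition op_spectrum :: "('a::complex_hilbert \<Rightarrow>\<^sub>L 'a) \<Rightarrow> complex set" where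
  "op_spectrum T = {z. \<not> invertible_op (T - scalar_op z)}"

definition self_adjoint :: "('a::complex_hilbert \<Rightarrow>\<^sub>L 'a) \<Rightarrow> bool" where
  "self_adjoint T \<longleftrightarrow> (\<forall>x y. cinner (blinfun_apply T x) y = cinner x (blinfun_apply T y))"

definition pos_semidef :: "('a::complex_hilbert \<Rightarrow>\<^sub>L 'a) \<Rightarrow> bool" where
  "pos_semidef T \<longleftrightarrow> T \<in> bounded_ops \<and> self_adjoint T \<and>
     (\<forall>x. 0 \<le> Re (cinner x (blinfun_apply T x)))"

definition pos_def :: "('a::complex_hilbert \<Rightarrow>\<^sub>L 'a) set"  (\<open>\<P>\<close>) where
  "\<P> = {T. pos_semidef T \<and> invertible_op T}"

definition loewner_le :: "('a::complex_hilbert \<Rightarrow>\<^sub>L 'a) \<Rightarrow> ('a \<Rightarrow>\<^sub>L 'a) \<Rightarrow> bool"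
    (infix \<open>\<le>\<^sub>L\<close> 50) where
  "X \<le>\<^sub>L Y \<longleftrightarrow> pos_semidef (Y - X)"


text \<open>
  Continuous functional calculus of a self-adjoint operator \<open>A\<close>: \<open>f(A)\<close> is the norm limit of
  \<open>P\<^sub>n(A)\<close>, where the \<open>P\<^sub>n\<close> are real polynomials converging to \<open>f\<close> uniformly on the (real)
  spectrum of \<open>A\<close>.  For \<open>f\<close> continuous on the spectrum such \<open>P\<^sub>n\<close> exist, and the limit exists and
  does not depend on their choice.
\<close>

definition op_power :: "('a::complex_hilbert \<Rightarrow>\<^sub>L 'a) \<Rightarrow> nat \<Rightarrow> ('a \<Rightarrow>\<^sub>L 'a)" where
  "op_power A k = ((\<lambda>T. A o\<^sub>L T) ^^ k) id_blinfun"

definition poly_op :: "real poly \<Rightarrow> ('a::complex_hilbert \<Rightarrow>\<^sub>L 'a) \<Rightarrow> ('a \<Rightarrow>\<^sub>L 'a)" where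
  "poly_op P A = (\<Sum>k\<le>degree P. coeff P k *\<^sub>R op_power A k)"

definition fun_calc :: "(real \<Rightarrow> real) \<Rightarrow> ('a::complex_hilbert \<Rightarrow>\<^sub>L 'a) \<Rightarrow> ('a \<Rightarrow>\<^sub>L 'a)" where
  "fun_calc f A = (THE T. \<exists>P :: nat \<Rightarrow> real poly.
     uniform_limit {t. complex_of_real t \<in> op_spectrum A} (\<lambda>n. poly (P n)) f sequentially \<and>
     (\<lambda>n. poly_op (P n) A) \<longlonglongrightarrow> T)"

definition op_powr :: "('a::complex_hilbert \<Rightarrow>\<^sub>L 'a) \<Rightarrow> real \<Rightarrow> ('a \<Rightarrow>\<^sub>L 'a)" where
  "op_powr A p = fun_calc (\<lambda>t. t powr p) A"

definition op_log :: "('a::complex_hilbert \<Rightarrow>\<^sub>L 'a) \<Rightarrow> ('a \<Rightarrow>\<^sub>L 'a)" where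
  "op_log A = fun_calc ln A"

definition op_exp :: "('a::complex_hilbert \<Rightarrow>\<^sub>L 'a) \<Rightarrow> ('a \<Rightarrow>\<^sub>L 'a)" where
  "op_exp A = fun_calc exp A"


definition geometric_mean ::
    "('a::complex_hilbert \<Rightarrow>\<^sub>L 'a) \<Rightarrow> ('a \<Rightarrow>\<^sub>L 'a) \<Rightarrow> ('a \<Rightarrow>\<^sub>L 'a)"  (infixl \<open>\<sharp>\<close> 70) where
  "A \<sharp> B = op_powr A (1/2)
     o\<^sub>L op_powr (op_powr A (-1/2) o\<^sub>L B o\<^sub>L op_powr A (-1/2)) (1/2)
     o\<^sub>L op_powr A (1/2)"

text \<open>The near-order, as a relation on \<open>\<P>\<close>.\<close>

definition near_le :: "('a::complex_hilbert \<Rightarrow>\<^sub>L 'a) \<Rightarrow> ('a \<Rightarrow>\<^sub>L 'a) \<Rightarrow> bool"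
    (infix \<open>\<preceq>\<close> 50) where
  "A \<preceq> B \<longleftrightarrow> A \<in> \<P> \<and> B \<in> \<P> \<and> id_blinfun \<le>\<^sub>L op_inverse A \<sharp> B"


text \<open>
  Tuples of length \<open>n\<close> are functions on \<open>nat\<close> of which only the values at \<open>1, \<dots>, n\<close> are used.
\<close>

definition prob_vectors :: "nat \<Rightarrow> (nat \<Rightarrow> real) set"  (\<open>\<Delta>\<close>) where
  "\<Delta> n = {w. (\<forall>j\<in>{1..n}. 0 < w j) \<and> (\<Sum>j=1..n. w j) = 1}"

definition arithmetic_mean ::
    "nat \<Rightarrow> (nat \<Rightarrow> real) \<Rightarrow> (nat \<Rightarrow> 'a::complex_hilbert \<Rightarrow>\<^sub>L 'a) \<Rightarrow> ('a \<Rightarrow>\<^sub>L 'a)" where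
  "arithmetic_mean n w A = (\<Sum>j=1..n. w j *\<^sub>R A j)"

definition harmonic_mean ::
    "nat \<Rightarrow> (nat \<Rightarrow> real) \<Rightarrow> (nat \<Rightarrow> 'a::complex_hilbert \<Rightarrow>\<^sub>L 'a) \<Rightarrow> ('a \<Rightarrow>\<^sub>L 'a)" where
  "harmonic_mean n w A = op_inverse (\<Sum>j=1..n. w j *\<^sub>R op_inverse (A j))"

definition log_euclidean_mean ::
    "nat \<Rightarrow> (nat \<Rightarrow> real) \<Rightarrow> (nat \<Rightarrow> 'a::complex_hilbert \<Rightarrow>\<^sub>L 'a) \<Rightarrow> ('a \<Rightarrow>\<^sub>L 'a)" where
  "log_euclidean_mean n w A = op_exp (\<Sum>j=1..n. w j *\<^sub>R op_log (A j))"

text \<open>The quasi-arithmetic mean of order 0 is the limit in operator norm for \<open>p \<rightarrow> 0\<close>, \<open>p \<noteq> 0\<close>.\<close>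

definition quasi_mean_nonzero ::
    "real \<Rightarrow> nat \<Rightarrow> (nat \<Rightarrow> real) \<Rightarrow> (nat \<Rightarrow> 'a::complex_hilbert \<Rightarrow>\<^sub>L 'a) \<Rightarrow> ('a \<Rightarrow>\<^sub>L 'a)" where
  "quasi_mean_nonzero p n w A = op_powr (\<Sum>j=1..n. w j *\<^sub>R op_powr (A j) p) (1 / p)"

definition quasi_mean ::
    "real \<Rightarrow> nat \<Rightarrow> (nat \<Rightarrow> real) \<Rightarrow> (nat \<Rightarrow> 'a::complex_hilbert \<Rightarrow>\<^sub>L 'a) \<Rightarrow> ('a \<Rightarrow>\<^sub>L 'a)" where
  "quasi_mean p n w A =
     (if p = 0 then Lim (at 0) (\<lambda>r. quasi_mean_nonzero r n w A) else quasi_mean_nonzero p n w A)"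

end

theory Submission
  imports Defs "HOL-Computational_Algebra.Fundamental_Theorem_Algebra"
begin

text \<open>
The seven means are compared through small powers.  If \<open>X\<^sup>t \<le> Y\<^sup>t\<close> in the Loewner order for some
\<open>t = 2\<^bsup>-k\<^esup>\<close>, then \<open>X \<preceq> Y\<close>: the Loewner order implies the near-order
(\<open>quadratic_form_le_imp_near_le\<close>), and the near-order survives squaring of both sides
(\<open>near_le_square\<close>), so the exponent can be doubled until it is \<open>1\<close> (\<open>near_le_of_dyadic_power\<close>).

Write \<open>S\<^sub>p = \<Sum>\<^sub>j w\<^sub>j A\<^sub>j\<^sup>p\<close>, so that \<open>Q\<^sub>p\<^sup>t = S\<^sub>p\<^bsup>t/p\<^esup>\<close>.  For \<open>0 < t \<le> p \<le> q\<close> the exponents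
\<open>p/q\<close> and \<open>t/p\<close> lie in the unit interval, where powers are operator concave and operator monotone
(\<open>op_powr_concave\<close>, \<open>op_powr_mono\<close>): concavity gives \<open>S\<^sub>p \<le> S\<^sub>q\<^bsup>p/q\<^esup>\<close>, and monotonicity turns this
into \<open>S\<^sub>p\<^bsup>t/p\<^esup> \<le> S\<^sub>q\<^bsup>t/q\<^esup>\<close>.  Hence \<open>Q\<^sub>p \<preceq> Q\<^sub>q\<close>.  The negative orders follow in the same way
from the exponents \<open>-p\<close> and \<open>-q\<close>, because inversion reverses the Loewner order.  The log-Euclidean mean is
the norm limit of \<open>Q\<^sub>r\<close> at \<open>r = 0\<close> (\<open>quasi_mean_tendsto_log_euclidean\<close>), and the near-order
is closed under norm limits (\<open>near_le_limit\<close>).  The arithmetic and harmonic means are \<open>Q\<^sub>1\<close>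
and \<open>Q\<^sub>-\<^sub>1\<close>.

All inequalities come from one principle, \<open>norm_le_imp_quadratic_form_le\<close>: for a positive \<open>S\<close> and a
Hermitian \<open>Y\<close>, \<open>Y\<^sup>2 \<le> S\<^sup>2\<close> implies \<open>Y \<le> S\<close>.  It contains the monotonicity of the square root.  In
the proofs \<open>X \<le> Y\<close> is written as an inequality of quadratic forms, and \<open>X \<preceq> Y\<close>
becomes \<open>X \<le> (X\<^bsup>1/2\<^esup> Y X\<^bsup>1/2\<^esup>)\<^bsup>1/2\<^esup>\<close> (\<open>near_le_iff\<close>).

The powers themselves rest on the continuous functional calculus.  It is well defined because
\<open>\<parallel>P(A)\<parallel>\<close> is at most the supremum of \<open>|P|\<close> over the real spectrum of \<open>A\<close>, for every real polynomial
\<open>P\<close> and Hermitian \<open>A\<close> (\<open>norm_poly_op_le\<close>).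
\<close>

text \<open>
This makes the bounded operators a complete space, so that norm limits of polynomials exist.
\<close>

subclass (in complex_hilbert) banach ..

section \<open>Hermitian operators\<close>

text \<open>
Symmetry is required for the real inner product only; complex linearity supplies the imaginary part
(\<open>hermitian_iff\<close>).  Thus all later estimates take place in a real Hilbert space.
\<close>

definition hermitian :: "('a::complex_hilbert \<Rightarrow>\<^sub>L 'a) set" where
  "hermitian = {T \<in> bounded_ops. \<forall>x y. T x \<bullet> y = x \<bullet> T y}"

lemma Im_cinner: "Im (cinner u v) = u \<bullet> ((- \<i>) *\<^sub>C v)" for u v :: "'a::complex_hilbert"
  by (simp add: inner_eq_Re_cinner cinner_scaleC_right)

lemma hermitian_iff: "T \<in> hermitian \<longleftrightarrow> T \<in> bounded_ops \<and> self_adjoint T"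
proof -
  have "self_adjoint T" if T: "T \<in> bounded_ops" and sym: "\<forall>x y. T x \<bullet> y = x \<bullet> T y"
    unfolding self_adjoint_def
  proof (intro allI complex_eqI)
    fix x y
    show "Re (cinner (T x) y) = Re (cinner x (T y))"
      using sym by (simp add: inner_eq_Re_cinner)
    have "T ((- \<i>) *\<^sub>C y) = (- \<i>) *\<^sub>C T y"
      using T by (simp add: bounded_ops_def)
    then show "Im (cinner (T x) y) = Im (cinner x (T y))"
      unfolding Im_cinner using sym by metis
  qed
  then show ?thesis
    by (auto simp: hermitian_def self_adjoint_def inner_eq_Re_cinner)
qed

lemma hermitian_inner: "T \<in> hermitian \<Longrightarrow> T x \<bullet> y = x \<bullet> T y"
  by (simp add: hermitian_def)

lemma hermitian_bounded_ops: "T \<in> hermitian \<Longrightarrow> T \<in> bounded_ops"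
  by (simp add: hermitian_def)

lemma pos_semidef_iff: "pos_semidef T \<longleftrightarrow> T \<in> hermitian \<and> (\<forall>x. 0 \<le> x \<bullet> T x)"
  by (auto simp: pos_semidef_def hermitian_iff inner_eq_Re_cinner)

lemma scaleC_diff_right: "a *\<^sub>C (x - y) = a *\<^sub>C x - a *\<^sub>C y" for x :: "'a::complex_hilbert"
  by (rule linear_diff[OF bounded_linear.linear[OF bounded_linear_scaleC]])

lemma scaleC_zero_right: "a *\<^sub>C 0 = (0::'a::complex_hilbert)"
  using scaleC_diff_right[of a "0::'a" 0] by simp

lemma scaleC_scaleR_commute: "a *\<^sub>C (r *\<^sub>R x) = r *\<^sub>R (a *\<^sub>C x)" for x :: "'a::complex_hilbert"
  by (rule linear_scale[OF bounded_linear.linear[OF bounded_linear_scaleC]])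

lemma hermitian_add: "S \<in> hermitian \<Longrightarrow> T \<in> hermitian \<Longrightarrow> S + T \<in> hermitian"
  by (simp add: hermitian_def bounded_ops_def blinfun.add_left inner_simps scaleC_add_right)

lemma hermitian_diff: "S \<in> hermitian \<Longrightarrow> T \<in> hermitian \<Longrightarrow> S - T \<in> hermitian"
  by (simp add: hermitian_def bounded_ops_def blinfun.diff_left inner_simps scaleC_diff_right)

lemma hermitian_scaleR: "T \<in> hermitian \<Longrightarrow> r *\<^sub>R T \<in> hermitian"
  by (simp add: hermitian_def bounded_ops_def blinfun.scaleR_left scaleC_scaleR_commute)

lemma hermitian_zero: "0 \<in> hermitian"
  by (simp add: hermitian_def bounded_ops_def scaleC_zero_right)

lemma hermitian_id: "id_blinfun \<in> hermitian"
  by (simp add: hermitian_def bounded_ops_def)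

lemma hermitian_sum: "(\<And>j. j \<in> J \<Longrightarrow> T j \<in> hermitian) \<Longrightarrow> (\<Sum>j\<in>J. T j) \<in> hermitian"
  by (induction J rule: infinite_finite_induct) (auto intro: hermitian_add hermitian_zero)

lemma hermitian_compose:
  assumes "S \<in> hermitian" "T \<in> hermitian" "S o\<^sub>L T = T o\<^sub>L S"
  shows "S o\<^sub>L T \<in> hermitian"
proof -
  have "S (T x) \<bullet> y = x \<bullet> S (T y)" for x y
    using assms by (metis hermitian_inner blinfun_apply_blinfun_compose)
  then show ?thesis
    using assms by (simp add: hermitian_def bounded_ops_def)
qed

lemma hermitian_sandwich:
  assumes "S \<in> hermitian" "T \<in> hermitian"
  shows "S o\<^sub>L T o\<^sub>L S \<in> hermitian"
  using assms by (simp add: hermitian_def bounded_ops_def)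

lemma hermitian_limit:
  assumes lim: "(X \<longlongrightarrow> T) F" and nontriv: "F \<noteq> bot" and ev: "\<forall>\<^sub>F i in F. X i \<in> hermitian"
  shows "T \<in> hermitian"
proof -
  have ap: "((\<lambda>i. X i x) \<longlongrightarrow> T x) F" for x
    by (intro tendsto_intros lim)
  have "T (c *\<^sub>C x) = c *\<^sub>C T x" for c x
  proof (rule tendsto_unique[OF nontriv ap])
    have "((\<lambda>i. c *\<^sub>C X i x) \<longlongrightarrow> c *\<^sub>C T x) F"
      by (rule bounded_linear.tendsto[OF bounded_linear_scaleC ap])
    then show "((\<lambda>i. X i (c *\<^sub>C x)) \<longlongrightarrow> c *\<^sub>C T x) F"
      by (rule Lim_transform_eventually)
        (use ev in eventually_elim, simp add: hermitian_def bounded_ops_def)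
  qed
  moreover have "T x \<bullet> y = x \<bullet> T y" for x y
  proof (rule tendsto_unique[OF nontriv])
    show "((\<lambda>i. X i x \<bullet> y) \<longlongrightarrow> T x \<bullet> y) F"
      by (intro tendsto_intros ap)
    have "((\<lambda>i. x \<bullet> X i y) \<longlongrightarrow> x \<bullet> T y) F"
      by (intro tendsto_intros ap)
    then show "((\<lambda>i. X i x \<bullet> y) \<longlongrightarrow> x \<bullet> T y) F"
      by (rule Lim_transform_eventually) (use ev in eventually_elim, simp add: hermitian_inner)
  qed
  ultimately show ?thesis
    by (simp add: hermitian_def bounded_ops_def)
qed

lemma loewner_le_iff:
  assumes "X \<in> hermitian" "Y \<in> hermitian"
  shows "X \<le>\<^sub>L Y \<longleftrightarrow> (\<forall>x. x \<bullet> X x \<le> x \<bullet> Y x)"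
  using assms by (simp add: loewner_le_def pos_semidef_iff hermitian_diff blinfun.diff_left inner_diff_right)


section \<open>Inverses\<close>

lemma blinfun_compose_assoc: "(R o\<^sub>L S) o\<^sub>L T = R o\<^sub>L (S o\<^sub>L T)"
  by (rule blinfun_eqI) simp

lemma compose_id [simp]: "T o\<^sub>L id_blinfun = T" "id_blinfun o\<^sub>L T = T"
  by (rule blinfun_eqI, simp)+

lemma inverse_opsI:
  assumes "T \<in> bounded_ops" "S o\<^sub>L T = id_blinfun" "T o\<^sub>L S = id_blinfun"
  shows "inverse_ops T S"
proof -
  have ST: "S (T x) = x" "T (S x) = x" for x
    using assms by (metis blinfun_apply_blinfun_compose blinfun_apply_id_blinfun)+
  have "S (c *\<^sub>C x) = c *\<^sub>C S x" for c x
  proof -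
    have "T (c *\<^sub>C S x) = c *\<^sub>C x"
      using assms(1) by (simp add: bounded_ops_def ST)
    then show ?thesis using ST by metis
  qed
  then show ?thesis
    using assms by (simp add: inverse_ops_def bounded_ops_def)
qed

lemma inverse_ops_unique: "inverse_ops T S \<Longrightarrow> inverse_ops T S' \<Longrightarrow> S' = S"
  using blinfun_compose_assoc[of S' T S] by (simp add: inverse_ops_def)

lemma op_inverse_eqI: "inverse_ops T S \<Longrightarrow> op_inverse T = S"
  unfolding op_inverse_def by (rule the_equality) (auto dest: inverse_ops_unique)

lemma invertible_compose:
  assumes "invertible_op S" "invertible_op T" "S \<in> bounded_ops" "T \<in> bounded_ops"
  shows "invertible_op (S o\<^sub>L T)"
proof -
  obtain S' T' where S': "inverse_ops S S'" and T': "inverse_ops T T'"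
    using assms by (auto simp: invertible_op_def)
  have "inverse_ops (S o\<^sub>L T) (T' o\<^sub>L S')"
  proof (rule inverse_opsI)
    show "S o\<^sub>L T \<in> bounded_ops" using assms by (simp add: bounded_ops_def)
    have 1: "T' (T x) = x" "T (T' x) = x" "S' (S x) = x" "S (S' x) = x" for x
      using S' T' by (metis inverse_ops_def blinfun_apply_blinfun_compose blinfun_apply_id_blinfun)+
    show "T' o\<^sub>L S' o\<^sub>L (S o\<^sub>L T) = id_blinfun" "S o\<^sub>L T o\<^sub>L (T' o\<^sub>L S') = id_blinfun"
      by (rule blinfun_eqI, simp add: 1)+
  qed
  then show ?thesis by (auto simp: invertible_op_def)
qed

lemma invertible_scaleR:
  assumes "invertible_op T" "T \<in> bounded_ops" "c \<noteq> 0"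
  shows "invertible_op (c *\<^sub>R T)"
proof -
  obtain T' where T': "inverse_ops T T'"
    using assms by (auto simp: invertible_op_def)
  have "inverse_ops (c *\<^sub>R T) ((1/c) *\<^sub>R T')"
  proof (rule inverse_opsI)
    show "c *\<^sub>R T \<in> bounded_ops" using assms
      by (simp add: bounded_ops_def blinfun.scaleR_left scaleC_scaleR_commute)
    have 1: "T' (T x) = x" "T (T' x) = x" for x
      using T' by (metis inverse_ops_def blinfun_apply_blinfun_compose blinfun_apply_id_blinfun)+
    show "(1/c) *\<^sub>R T' o\<^sub>L c *\<^sub>R T = id_blinfun" "c *\<^sub>R T o\<^sub>L (1/c) *\<^sub>R T' = id_blinfun"
      by (rule blinfun_eqI, simp add: 1 blinfun.scaleR_left blinfun.scaleR_right \<open>c \<noteq> 0\<close>)+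
  qed
  then show ?thesis by (auto simp: invertible_op_def)
qed

text \<open>
The proof of the Lax--Milgram theorem by a fixed point: \<open>T x = y\<close> says that \<open>x\<close> is fixed
by \<open>x \<mapsto> x - \<tau> (T x - y)\<close>, and for the right \<open>\<tau>\<close> this map is a contraction.
\<close>

lemma coercive_bij:
  fixes T :: "'a::complex_hilbert \<Rightarrow>\<^sub>L 'a"
  assumes c: "0 < c" and coercive: "\<And>x. c * (norm x)\<^sup>2 \<le> x \<bullet> T x"
  shows "\<exists>!x. T x = y"
proof -
  define K where "K = norm T + c"
  have K: "0 < K" "c \<le> K" and TK: "norm (T x) \<le> K * norm x" for x
  proof -
    show "0 < K" "c \<le> K" using c by (simp_all add: K_def add_nonneg_pos)
    have "norm (T x) \<le> norm T * norm x" by (rule norm_blinfun)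
    also have "\<dots> \<le> K * norm x" unfolding K_def by (rule mult_right_mono) (use c in auto)
    finally show "norm (T x) \<le> K * norm x" .
  qed
  \<comment> \<open>the minimiser of \<open>1 - 2 \<tau> c + \<tau>\<^sup>2 K\<^sup>2\<close>, which bounds the squared contraction factor\<close>
  define \<tau> where "\<tau> = c / K\<^sup>2"
  define \<kappa> where "\<kappa> = sqrt (1 - c\<^sup>2 / K\<^sup>2)"
  have le1: "c\<^sup>2 / K\<^sup>2 \<le> 1" using K c by (simp add: power_mono)
  have contr: "norm (x - \<tau> *\<^sub>R T x) \<le> \<kappa> * norm x" for x
  proof (rule power2_le_imp_le)
    have "(norm (x - \<tau> *\<^sub>R T x))\<^sup>2 = (norm x)\<^sup>2 - 2 * \<tau> * (x \<bullet> T x) + \<tau>\<^sup>2 * (norm (T x))\<^sup>2"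
      unfolding power2_norm_eq_inner
      by (simp add: inner_diff_left inner_diff_right inner_commute[of "T x" x])
        (simp add: power2_eq_square right_diff_distrib)
    also have "\<dots> \<le> (norm x)\<^sup>2 - 2 * \<tau> * (c * (norm x)\<^sup>2) + \<tau>\<^sup>2 * (K * norm x)\<^sup>2"
    proof -
      have "2 * \<tau> * (c * (norm x)\<^sup>2) \<le> 2 * \<tau> * (x \<bullet> T x)"
        by (rule mult_left_mono[OF coercive]) (use c in \<open>simp add: \<tau>_def\<close>)
      moreover have "\<tau>\<^sup>2 * (norm (T x))\<^sup>2 \<le> \<tau>\<^sup>2 * (K * norm x)\<^sup>2"
        by (rule mult_left_mono[OF power_mono[OF TK]]) simp_all
      ultimately show ?thesis by linarith
    qed
    also have "\<dots> = (1 - (2 * \<tau> * c - \<tau>\<^sup>2 * K\<^sup>2)) * (norm x)\<^sup>2"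
      by (simp add: power_mult_distrib algebra_simps)
    also have "\<dots> = (1 - c\<^sup>2 / K\<^sup>2) * (norm x)\<^sup>2"
      using K by (simp add: \<tau>_def power_divide field_simps power2_eq_square)
    also have "\<dots> = (\<kappa> * norm x)\<^sup>2"
      using le1 by (simp add: \<kappa>_def power_mult_distrib)
    finally show "(norm (x - \<tau> *\<^sub>R T x))\<^sup>2 \<le> (\<kappa> * norm x)\<^sup>2" .
    show "0 \<le> \<kappa> * norm x" using le1 by (simp add: \<kappa>_def)
  qed
  have "\<exists>!x. x - \<tau> *\<^sub>R (T x - y) = x"
  proof (rule banach_fix_type)
    show "0 \<le> \<kappa>" using le1 by (simp add: \<kappa>_def)
    show "\<kappa> < 1" using K c by (simp add: \<kappa>_def)
    show "\<forall>u v. dist (u - \<tau> *\<^sub>R (T u - y)) (v - \<tau> *\<^sub>R (T v - y)) \<le> \<kappa> * dist u v"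
    proof (intro allI)
      fix u v
      have "u - \<tau> *\<^sub>R (T u - y) - (v - \<tau> *\<^sub>R (T v - y)) = (u - v) - \<tau> *\<^sub>R T (u - v)"
        by (simp add: blinfun.diff_right algebra_simps)
      then show "dist (u - \<tau> *\<^sub>R (T u - y)) (v - \<tau> *\<^sub>R (T v - y)) \<le> \<kappa> * dist u v"
        using contr[of "u - v"] by (simp only: dist_norm)
    qed
  qed
  moreover have "x - \<tau> *\<^sub>R (T x - y) = x \<longleftrightarrow> T x = y" for x
    using c K by (simp add: \<tau>_def)
  ultimately show ?thesis by simp
qed

lemma coercive_invertible:
  fixes T :: "'a::complex_hilbert \<Rightarrow>\<^sub>L 'a"
  assumes T: "T \<in> bounded_ops" and c: "0 < c" and coercive: "\<And>x. c * (norm x)\<^sup>2 \<le> x \<bullet> T x"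
  shows "invertible_op T"
proof -
  define S where "S = (\<lambda>y. THE x. T x = y)"
  have TS: "T (S y) = y" for y
    unfolding S_def by (rule theI'[OF coercive_bij[OF c coercive]])
  have ST: "S (T x) = x" for x
    unfolding S_def by (rule the1_equality[OF coercive_bij[OF c coercive] refl])
  have eqI: "u = v" if "T u = T v" for u v
    by (rule box_equals[OF arg_cong[OF that, of S] ST ST])
  have bound: "norm (S y) \<le> norm y * (1/c)" for y
  proof -
    have "c * (norm (S y))\<^sup>2 \<le> S y \<bullet> y"
      using coercive[of "S y"] by (simp add: TS)
    also have "\<dots> \<le> norm (S y) * norm y" by (rule norm_cauchy_schwarz)
    finally have "norm (S y) * (c * norm (S y)) \<le> norm (S y) * norm y"
      by (simp only: power2_eq_square mult.left_commute)
    then have "norm (S y) > 0 \<Longrightarrow> c * norm (S y) \<le> norm y"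
      by simp
    then have "c * norm (S y) \<le> norm y"
      by (cases "norm (S y) = 0") simp_all
    then show ?thesis using c by (simp add: pos_le_divide_eq mult.commute)
  qed
  have lin: "bounded_linear S"
  proof (rule bounded_linear_intro[OF _ _ bound])
    show "S (u + v) = S u + S v" for u v
      by (rule eqI) (simp add: TS blinfun.add_right)
    show "S (r *\<^sub>R u) = r *\<^sub>R S u" for r u
      by (rule eqI) (simp add: TS blinfun.scaleR_right)
  qed
  have "inverse_ops T (Blinfun S)"
    by (rule inverse_opsI[OF T])
      (rule blinfun_eqI, simp add: bounded_linear_Blinfun_apply[OF lin] ST TS)+
  then show ?thesis by (auto simp: invertible_op_def)
qed

section \<open>Polynomials of an operator\<close>

lemma poly_op_eq_sum:
  assumes "degree P \<le> N"
  shows "poly_op P A = (\<Sum>k\<le>N. coeff P k *\<^sub>R op_power A k)"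
  unfolding poly_op_def
  by (rule sum.mono_neutral_left) (use assms in \<open>auto simp: coeff_eq_0\<close>)

lemma op_power_Suc: "op_power A (Suc k) = A o\<^sub>L op_power A k"
  and op_power_0: "op_power A 0 = id_blinfun"
  by (simp_all add: op_power_def)

lemma poly_op_add: "poly_op (P + Q) A = poly_op P A + poly_op Q A"
proof -
  let ?N = "max (degree P) (degree Q)"
  have "degree (P + Q) \<le> ?N" by (rule degree_add_le_max)
  then show ?thesis
    by (simp add: poly_op_eq_sum[of _ ?N] scaleR_add_left sum.distrib)
qed

lemma poly_op_smult: "poly_op (smult c P) A = c *\<^sub>R poly_op P A"
  by (simp add: poly_op_eq_sum[of _ "degree P"] degree_smult_le scaleR_sum_right)

lemma poly_op_0: "poly_op 0 A = 0"
  by (simp add: poly_op_def)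

lemma poly_op_diff: "poly_op (P - Q) A = poly_op P A - poly_op Q A"
  using poly_op_add[of P "- Q" A] poly_op_smult[of "-1" Q A] by simp

lemma poly_op_pCons: "poly_op (pCons a P) A = a *\<^sub>R id_blinfun + (A o\<^sub>L poly_op P A)"
proof -
  have "poly_op (pCons a P) A = (\<Sum>k\<le>Suc (degree P). coeff (pCons a P) k *\<^sub>R op_power A k)"
    by (rule poly_op_eq_sum) (simp add: degree_pCons_le)
  also have "\<dots> = a *\<^sub>R id_blinfun + (\<Sum>k\<le>degree P. coeff P k *\<^sub>R (A o\<^sub>L op_power A k))"
    by (simp add: sum.atMost_Suc_shift op_power_0 op_power_Suc del: sum.atMost_Suc)
  also have "(\<Sum>k\<le>degree P. coeff P k *\<^sub>R (A o\<^sub>L op_power A k)) = A o\<^sub>L poly_op P A"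
    unfolding poly_op_def
    by (simp add: bounded_bilinear.sum_right[OF bounded_bilinear_blinfun_compose]
        bounded_bilinear.scaleR_right[OF bounded_bilinear_blinfun_compose])
  finally show ?thesis .
qed

lemma poly_op_mult: "poly_op (P * Q) A = poly_op P A o\<^sub>L poly_op Q A"
  by (induction P)
    (simp_all add: poly_op_0 poly_op_pCons poly_op_add poly_op_smult blinfun_compose_assoc
      bounded_bilinear.add_left[OF bounded_bilinear_blinfun_compose]
      bounded_bilinear.scaleR_left[OF bounded_bilinear_blinfun_compose]
      bounded_bilinear.zero_left[OF bounded_bilinear_blinfun_compose])

lemma poly_op_const: "poly_op [:c:] A = c *\<^sub>R id_blinfun"
  and poly_op_X: "poly_op [:0, 1:] A = A"
  by (simp_all add: poly_op_pCons poly_op_0 bounded_bilinear.zero_right[OF bounded_bilinear_blinfun_compose])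

lemma poly_op_commute: "poly_op P A o\<^sub>L poly_op Q A = poly_op Q A o\<^sub>L poly_op P A"
  by (metis poly_op_mult mult.commute)

lemma hermitian_poly_op:
  assumes "A \<in> hermitian"
  shows "poly_op P A \<in> hermitian"
proof (induction P)
  case 0
  show ?case by (simp add: poly_op_0 hermitian_zero)
next
  case (pCons a P)
  have "A o\<^sub>L poly_op P A = poly_op P A o\<^sub>L A"
    using poly_op_commute[of "[:0, 1:]" A P] by (simp add: poly_op_X)
  then show ?case
    unfolding poly_op_pCons
    using assms pCons by (intro hermitian_add hermitian_scaleR hermitian_id hermitian_compose)
qed


section \<open>The real spectrum\<close>

abbreviation real_spectrum :: "('a::complex_hilbert \<Rightarrow>\<^sub>L 'a) \<Rightarrow> real set" where
  "real_spectrum A \<equiv> {t. complex_of_real t \<in> op_spectrum A}"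

lemma real_spectrum_iff:
  fixes A :: "'a::complex_hilbert \<Rightarrow>\<^sub>L 'a"
  shows "t \<in> real_spectrum A \<longleftrightarrow> \<not> invertible_op (A - t *\<^sub>R id_blinfun)"
proof -
  have "scalar_op (complex_of_real t) = t *\<^sub>R (id_blinfun :: 'a \<Rightarrow>\<^sub>L 'a)"
    by (rule blinfun_eqI) (simp add: scalar_op.rep_eq scaleC_complex_of_real blinfun.scaleR_left)
  then show ?thesis by (simp add: op_spectrum_def)
qed

lemma invertible_id: "invertible_op id_blinfun"
  unfolding invertible_op_def
  by (rule exI[of _ id_blinfun], rule inverse_opsI) (simp_all add: hermitian_bounded_ops hermitian_id)

lemma poly_map_of_real_add:
  "poly (map_poly complex_of_real (p + q)) z
    = poly (map_poly complex_of_real p) z + poly (map_poly complex_of_real q) z"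
  by (induction p q rule: poly_induct2) (simp_all add: map_poly_pCons algebra_simps)

lemma poly_map_of_real_mult:
  "poly (map_poly complex_of_real (p * q)) z
    = poly (map_poly complex_of_real p) z * poly (map_poly complex_of_real q) z"
  by (induction p) (simp_all add: map_poly_pCons poly_map_of_real_add map_poly_smult algebra_simps)

text \<open>
The quadratic vanishes at \<open>z\<close>.  So the remainder of \<open>Q\<close> vanishes there too, and a real
polynomial of degree at most one with a nonreal root is zero.
\<close>

lemma quadratic_dvd_of_nonreal_root:
  fixes Q :: "real poly"
  assumes root: "poly (map_poly complex_of_real Q) z = 0" and "Im z \<noteq> 0"
  shows "[:- Re z, 1:] * [:- Re z, 1:] + [:(Im z)\<^sup>2:] dvd Q" (is "?q dvd Q")
proof -
  let ?ev = "\<lambda>p. poly (map_poly complex_of_real p) z"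
  have q0: "?ev ?q = 0"
    by (simp add: poly_map_of_real_add poly_map_of_real_mult map_poly_pCons
        complex_eq_iff power2_eq_square)
  have deg: "degree ?q = 2" by simp
  define R where "R = Q mod ?q"
  have "Q = ?q * (Q div ?q) + R" by (simp only: R_def mult_div_mod_eq)
  then have "?ev Q = ?ev ?q * ?ev (Q div ?q) + ?ev R"
    by (metis poly_map_of_real_add poly_map_of_real_mult)
  then have R0: "?ev R = 0" using root q0 by simp
  have "?q \<noteq> 0" using deg by fastforce
  then have "R = 0 \<or> degree R < degree ?q"
    unfolding R_def by (rule degree_mod_less)
  then have "degree R \<le> 1" unfolding deg by auto
  then have "R = [:coeff R 0, coeff R 1:]"
    by (intro poly_eqI) (auto simp: coeff_pCons coeff_eq_0 split: nat.split)
  then obtain a b where R: "R = [:a, b:]" by blast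
  have "b * Im z = 0" "a + b * Re z = 0"
    using R0 by (simp_all add: R map_poly_pCons complex_eq_iff mult.commute)
  then have "R = 0" using \<open>Im z \<noteq> 0\<close> R by simp
  then show ?thesis by (simp add: R_def mod_eq_0_iff_dvd)
qed

text \<open>
Split off one irreducible real factor at a time.  A linear factor \<open>A - t\<close> is invertible because \<open>t\<close>
is a root of \<open>Q\<close> and hence outside the spectrum; a factor \<open>(A - a)\<^sup>2 + b\<^sup>2\<close> with \<open>b \<noteq> 0\<close> is coercive.
\<close>

lemma invertible_poly_op:
  assumes A: "A \<in> hermitian"
  shows "Q \<noteq> 0 \<Longrightarrow> (\<And>t. t \<in> real_spectrum A \<Longrightarrow> poly Q t \<noteq> 0) \<Longrightarrow> invertible_op (poly_op Q A)"
proof (induction "degree Q" arbitrary: Q rule: less_induct)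
  case less
  have bd: "poly_op P A \<in> bounded_ops" for P
    using hermitian_poly_op[OF A] by (rule hermitian_bounded_ops)
  have factor: "invertible_op (poly_op Q A)"
    if q: "q dvd Q" "degree q > 0" "invertible_op (poly_op q A)" for q
  proof -
    obtain D where D: "Q = q * D" using q(1) by (auto simp: dvd_def)
    have nz: "q \<noteq> 0" "D \<noteq> 0" using less.prems(1) D by auto
    have "invertible_op (poly_op D A)"
    proof (rule less.hyps)
      show "degree D < degree Q" using D nz q(2) by (simp add: degree_mult_eq)
      show "D \<noteq> 0" by (rule nz(2))
      show "poly D t \<noteq> 0" if "t \<in> real_spectrum A" for t
        using less.prems(2)[OF that] D by auto
    qed
    then show ?thesis
      unfolding D poly_op_mult by (intro invertible_compose q(3) bd)
  qed
  show ?case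
  proof (cases "degree Q = 0")
    case True
    then obtain c where c: "Q = [:c:]" by (rule degree_eq_zeroE)
    then show ?thesis
      using less.prems(1)
      by (simp add: poly_op_const invertible_scaleR invertible_id hermitian_bounded_ops hermitian_id)
  next
    case False
    have "degree (map_poly complex_of_real Q) = degree Q"
      by (rule degree_map_poly) simp
    then have "\<not> constant (poly (map_poly complex_of_real Q))"
      using False by (simp add: constant_degree)
    then obtain z where z: "poly (map_poly complex_of_real Q) z = 0"
      using fundamental_theorem_of_algebra by blast
    show ?thesis
    proof (cases "Im z = 0")
      case True
      then have "z = complex_of_real (Re z)" by (simp add: complex_eq_iff)
      moreover have "poly (map_poly complex_of_real p) (complex_of_real t) = complex_of_real (poly p t)" for p t
        by (induction p) (simp_all add: map_poly_pCons)
      ultimately have root: "poly Q (Re z) = 0" using z by (metis of_real_eq_0_iff)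
      then have "Re z \<notin> real_spectrum A" using less.prems(2) by blast
      moreover have "poly_op [:- Re z, 1:] A = A - Re z *\<^sub>R id_blinfun"
        by (simp add: poly_op_pCons poly_op_0)
      ultimately have "invertible_op (poly_op [:- Re z, 1:] A)"
        by (simp only: real_spectrum_iff not_not)
      then show ?thesis
        using root by (intro factor[of "[:- Re z, 1:]"]) (simp_all add: poly_eq_0_iff_dvd)
    next
      case False
      let ?B = "poly_op [:- Re z, 1:] A"
      let ?q = "[:- Re z, 1:] * [:- Re z, 1:] + [:(Im z)\<^sup>2:]"
      have "invertible_op (poly_op ?q A)"
      proof (rule coercive_invertible[OF bd])
        show "0 < (Im z)\<^sup>2" using False by simp
        fix x
        have "x \<bullet> poly_op ?q A x = x \<bullet> ?B (?B x) + (Im z)\<^sup>2 * (x \<bullet> x)"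
          by (simp only: poly_op_add poly_op_mult poly_op_const blinfun.add_left blinfun.scaleR_left
              inner_add_right inner_scaleR_right blinfun_apply_blinfun_compose blinfun_apply_id_blinfun)
        also have "x \<bullet> ?B (?B x) = ?B x \<bullet> ?B x"
          by (rule hermitian_inner[OF hermitian_poly_op[OF A], symmetric])
        finally show "(Im z)\<^sup>2 * (norm x)\<^sup>2 \<le> x \<bullet> poly_op ?q A x"
          by (simp only: power2_norm_eq_inner) simp
      qed
      then show ?thesis
        by (intro factor[OF quadratic_dvd_of_nonreal_root[OF z False]]) simp_all
    qed
  qed
qed

text \<open>
Vectors at which \<open>T\<close> nearly attains its norm are approximate eigenvectors of \<open>T\<^sup>2\<close> for
\<open>\<parallel>T\<parallel>\<^sup>2\<close>, since \<open>\<parallel>(\<mu>\<^sup>2 - T\<^sup>2) x\<parallel>\<^sup>2 \<le> \<mu>\<^sup>2 (\<mu>\<^sup>2 \<parallel>x\<parallel>\<^sup>2 - \<parallel>T x\<parallel>\<^sup>2)\<close> for \<open>\<mu> = \<parallel>T\<parallel>\<close>.  A bounded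
inverse would keep the right-hand side away from zero, and then \<open>\<parallel>T\<parallel> < \<mu>\<close>.
\<close>

lemma not_invertible_norm_squared:
  assumes T: "T \<in> hermitian" and "T \<noteq> 0"
  shows "\<not> invertible_op ((norm T)\<^sup>2 *\<^sub>R id_blinfun - (T o\<^sub>L T))" (is "\<not> invertible_op ?V")
proof
  assume "invertible_op ?V"
  then obtain S where S: "S o\<^sub>L ?V = id_blinfun"
    by (auto simp: invertible_op_def inverse_ops_def)
  define \<mu> where "\<mu> = norm T"
  define s where "s = norm S + 1"
  have \<mu>: "0 < \<mu>" using \<open>T \<noteq> 0\<close> by (simp add: \<mu>_def)
  have s: "0 < s" by (simp add: s_def add_nonneg_pos)
  define \<delta> where "\<delta> = 1 / (s\<^sup>2 * \<mu>\<^sup>2)"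
  have \<delta>: "0 < \<delta>" using s \<mu> by (simp add: \<delta>_def)
  have *: "(norm (T x))\<^sup>2 \<le> (\<mu>\<^sup>2 - \<delta>) * (norm x)\<^sup>2" for x
  proof -
    have Vx: "?V x = \<mu>\<^sup>2 *\<^sub>R x - T (T x)"
      by (simp add: blinfun.diff_left blinfun.scaleR_left \<mu>_def)
    have sym: "x \<bullet> T (T x) = T x \<bullet> T x"
      by (rule hermitian_inner[OF T, symmetric])
    have "norm (T (T x)) \<le> \<mu> * norm (T x)" unfolding \<mu>_def by (rule norm_blinfun)
    then have TT: "(norm (T (T x)))\<^sup>2 \<le> \<mu>\<^sup>2 * (norm (T x))\<^sup>2"
      by (metis norm_ge_zero power_mono power_mult_distrib)
    have "(norm (?V x))\<^sup>2 = (\<mu>\<^sup>2 * \<mu>\<^sup>2) * (norm x)\<^sup>2 - 2 * \<mu>\<^sup>2 * (norm (T x))\<^sup>2 + (norm (T (T x)))\<^sup>2"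
      unfolding Vx power2_norm_eq_inner inner_diff_left inner_diff_right inner_scaleR_left inner_scaleR_right
        inner_commute[of "T (T x)" x] sym
      by (simp add: algebra_simps)
    then have V: "(norm (?V x))\<^sup>2 \<le> \<mu>\<^sup>2 * (\<mu>\<^sup>2 * (norm x)\<^sup>2 - (norm (T x))\<^sup>2)"
      using TT by (simp add: algebra_simps)
    have "x = S (?V x)"
      using S by (metis blinfun_apply_blinfun_compose blinfun_apply_id_blinfun)
    then have "norm x \<le> norm S * norm (?V x)"
      by (metis norm_blinfun)
    also have "\<dots> \<le> s * norm (?V x)" unfolding s_def by (rule mult_right_mono) simp_all
    finally have "(norm x)\<^sup>2 \<le> s\<^sup>2 * (norm (?V x))\<^sup>2"
      by (metis norm_ge_zero power_mono power_mult_distrib)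
    also have "\<dots> \<le> s\<^sup>2 * (\<mu>\<^sup>2 * (\<mu>\<^sup>2 * (norm x)\<^sup>2 - (norm (T x))\<^sup>2))"
      by (rule mult_left_mono[OF V]) simp
    finally have "\<delta> * (norm x)\<^sup>2 \<le> \<mu>\<^sup>2 * (norm x)\<^sup>2 - (norm (T x))\<^sup>2"
      using s \<mu> by (simp add: \<delta>_def pos_divide_le_eq ac_simps)
    then show ?thesis by (simp add: algebra_simps)
  qed
  have "norm (T x) \<le> sqrt (max 0 (\<mu>\<^sup>2 - \<delta>)) * norm x" for x
  proof (rule power2_le_imp_le)
    have "(\<mu>\<^sup>2 - \<delta>) * (norm x)\<^sup>2 \<le> max 0 (\<mu>\<^sup>2 - \<delta>) * (norm x)\<^sup>2"
      by (rule mult_right_mono) simp_all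
    then show "(norm (T x))\<^sup>2 \<le> (sqrt (max 0 (\<mu>\<^sup>2 - \<delta>)) * norm x)\<^sup>2"
      using *[of x] by (simp add: power_mult_distrib)
  qed simp
  then have "\<mu> \<le> sqrt (max 0 (\<mu>\<^sup>2 - \<delta>))"
    unfolding \<mu>_def by (intro norm_blinfun_bound) simp_all
  also have "\<dots> < sqrt (\<mu>\<^sup>2)"
    using \<delta> \<mu> by (intro real_sqrt_less_mono) simp
  finally show False using \<mu> by simp
qed

text \<open>
If the spectrum were empty, the polynomial \<open>\<parallel>A\<parallel>\<^sup>2 - t\<^sup>2\<close> would have no root in it and so be invertible
at \<open>A\<close>.  Only on the zero space, where every operator is invertible, is the spectrum empty.
\<close>

lemma real_spectrum_nonempty:
  fixes A :: "'a::complex_hilbert \<Rightarrow>\<^sub>L 'a"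
  assumes A: "A \<in> hermitian" and nontriv: "(x::'a) \<noteq> 0"
  shows "real_spectrum A \<noteq> {}"
proof (cases "A = 0")
  case True
  have "\<not> invertible_op (0 :: 'a \<Rightarrow>\<^sub>L 'a)"
  proof
    assume "invertible_op (0 :: 'a \<Rightarrow>\<^sub>L 'a)"
    then obtain S :: "'a \<Rightarrow>\<^sub>L 'a" where "S o\<^sub>L 0 = id_blinfun"
      by (auto simp: invertible_op_def inverse_ops_def)
    then have "S (blinfun_apply 0 x) = x" by (metis blinfun_apply_blinfun_compose blinfun_apply_id_blinfun)
    then show False using nontriv by simp
  qed
  then have "0 \<in> real_spectrum A" unfolding real_spectrum_iff True by simp
  then show ?thesis by blast
next
  case False
  define Q where "Q = [:(norm A)\<^sup>2:] - [:0, 1:] * [:0, 1:]"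
  have "Q \<noteq> 0" by (simp add: Q_def)
  have "poly_op Q A = (norm A)\<^sup>2 *\<^sub>R id_blinfun - (A o\<^sub>L A)"
    by (simp only: Q_def poly_op_diff poly_op_mult poly_op_const poly_op_X)
  then have "\<not> invertible_op (poly_op Q A)"
    using not_invertible_norm_squared[OF A False] by simp
  then show ?thesis
    using invertible_poly_op[OF A \<open>Q \<noteq> 0\<close>] by blast
qed

text \<open>
If \<open>\<parallel>P(A)\<parallel>\<close> exceeded \<open>r\<close>, the polynomial \<open>\<parallel>P(A)\<parallel>\<^sup>2 - P\<^sup>2\<close> would be positive on the spectrum
and so invertible at \<open>A\<close>, against the previous lemmas.  Nonemptiness of the spectrum excludes the case
that this polynomial is zero.
\<close>

lemma norm_poly_op_le:
  assumes A: "A \<in> hermitian" and "0 \<le> r" and bound: "\<And>t. t \<in> real_spectrum A \<Longrightarrow> \<bar>poly P t\<bar> \<le> r"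
  shows "norm (poly_op P A) \<le> r"
proof (rule ccontr)
  assume "\<not> norm (poly_op P A) \<le> r"
  then have gt: "r < norm (poly_op P A)" by simp
  then have nz: "poly_op P A \<noteq> 0" using \<open>0 \<le> r\<close> by auto
  define Q where "Q = [:(norm (poly_op P A))\<^sup>2:] - P * P"
  have "poly_op Q A = (norm (poly_op P A))\<^sup>2 *\<^sub>R id_blinfun - (poly_op P A o\<^sub>L poly_op P A)"
    by (simp only: Q_def poly_op_diff poly_op_mult poly_op_const)
  then have ninv: "\<not> invertible_op (poly_op Q A)"
    using not_invertible_norm_squared[OF hermitian_poly_op[OF A] nz] by simp
  have pos: "poly Q t \<noteq> 0" if "t \<in> real_spectrum A" for t
  proof -
    have "\<bar>poly P t\<bar>\<^sup>2 < (norm (poly_op P A))\<^sup>2"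
      by (rule power_strict_mono) (use bound[OF that] gt in auto)
    then show ?thesis by (simp add: Q_def power2_eq_square)
  qed
  obtain x where "poly_op P A x \<noteq> 0"
    using nz by (metis blinfun_eqI blinfun.zero_left)
  then have "real_spectrum A \<noteq> {}"
    by (rule real_spectrum_nonempty[OF A])
  then have "Q \<noteq> 0" using pos by auto
  then show False using invertible_poly_op[OF A _ pos] ninv by blast
qed

text \<open>
The operators between \<open>m\<close> and \<open>M\<close> times the identity.  Functions are controlled on \<open>{m..M}\<close>, which contains
the spectrum, and not on the spectrum itself: an interval can serve a whole family of operators.
\<close>

definition operator_interval :: "real \<Rightarrow> real \<Rightarrow> ('a::complex_hilbert \<Rightarrow>\<^sub>L 'a) set" where
  "operator_interval m M =
     {A \<in> hermitian. \<forall>x. m * (norm x)\<^sup>2 \<le> x \<bullet> A x \<and> x \<bullet> A x \<le> M * (norm x)\<^sup>2}"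

lemma real_spectrum_subset:
  assumes A: "A \<in> operator_interval m M"
  shows "real_spectrum A \<subseteq> {m..M}"
proof
  fix t assume t: "t \<in> real_spectrum A"
  have herm: "A \<in> hermitian" using A by (simp add: operator_interval_def)
  then have bd: "A - t *\<^sub>R id_blinfun \<in> bounded_ops"
    by (intro hermitian_bounded_ops hermitian_diff hermitian_scaleR hermitian_id)
  have lo: "m * (norm x)\<^sup>2 \<le> x \<bullet> A x" and hi: "x \<bullet> A x \<le> M * (norm x)\<^sup>2" for x
    using A by (auto simp: operator_interval_def)
  have ap: "x \<bullet> (A - t *\<^sub>R id_blinfun) x = x \<bullet> A x - t * (norm x)\<^sup>2" for x
    by (simp add: blinfun.diff_left blinfun.scaleR_left inner_diff_right power2_norm_eq_inner)
  have "m \<le> t"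
  proof (rule ccontr)
    assume "\<not> m \<le> t"
    then have "invertible_op (A - t *\<^sub>R id_blinfun)"
      by (intro coercive_invertible[OF bd, of "m - t"]) (use lo in \<open>simp_all add: ap left_diff_distrib\<close>)
    then show False using t by (simp only: real_spectrum_iff not_True_eq_False)
  qed
  moreover have "t \<le> M"
  proof (rule ccontr)
    assume "\<not> t \<le> M"
    have neg: "t *\<^sub>R id_blinfun - A \<in> bounded_ops"
      using herm by (intro hermitian_bounded_ops hermitian_diff hermitian_scaleR hermitian_id)
    have "x \<bullet> (t *\<^sub>R id_blinfun - A) x = t * (norm x)\<^sup>2 - x \<bullet> A x" for x
      by (simp add: blinfun.diff_left blinfun.scaleR_left inner_diff_right power2_norm_eq_inner)
    then have "invertible_op (t *\<^sub>R id_blinfun - A)"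
      using \<open>\<not> t \<le> M\<close> by (intro coercive_invertible[OF neg, of "t - M"]) (use hi in \<open>simp_all add: left_diff_distrib\<close>)
    then have "invertible_op ((-1) *\<^sub>R (t *\<^sub>R id_blinfun - A))"
      by (rule invertible_scaleR[OF _ neg]) simp
    then have "invertible_op (A - t *\<^sub>R id_blinfun)" by simp
    then show False using t by (simp only: real_spectrum_iff not_True_eq_False)
  qed
  ultimately show "t \<in> {m..M}" by simp
qed

section \<open>Functional calculus\<close>

lemma operator_interval_hermitian: "A \<in> operator_interval m M \<Longrightarrow> A \<in> hermitian"
  by (simp add: operator_interval_def)

lemma norm_poly_op_diff_le:
  assumes A: "A \<in> hermitian" and "0 \<le> r"
    and "\<And>t. t \<in> real_spectrum A \<Longrightarrow> \<bar>poly P t - poly Q t\<bar> \<le> r"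
  shows "norm (poly_op P A - poly_op Q A) \<le> r"
  using norm_poly_op_le[OF A \<open>0 \<le> r\<close>, of "P - Q"] assms(3) by (simp add: poly_op_diff)

text \<open>
Two approximating sequences of polynomials differ on the spectrum by a null sequence, hence in
operator norm by the bound for polynomials.
\<close>

lemma fun_calc_eqI:
  assumes A: "A \<in> hermitian"
    and ul: "uniform_limit (real_spectrum A) (\<lambda>n. poly (P n)) f sequentially"
    and lim: "(\<lambda>n. poly_op (P n) A) \<longlonglongrightarrow> T"
  shows "fun_calc f A = T"
  unfolding fun_calc_def
proof (rule the_equality)
  show "\<exists>P. uniform_limit (real_spectrum A) (\<lambda>n. poly (P n)) f sequentially \<and>
     (\<lambda>n. poly_op (P n) A) \<longlonglongrightarrow> T"
    using ul lim by blast
  fix T'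
  assume "\<exists>P. uniform_limit (real_spectrum A) (\<lambda>n. poly (P n)) f sequentially \<and>
     (\<lambda>n. poly_op (P n) A) \<longlonglongrightarrow> T'"
  then obtain P' where ul': "uniform_limit (real_spectrum A) (\<lambda>n. poly (P' n)) f sequentially"
    and lim': "(\<lambda>n. poly_op (P' n) A) \<longlonglongrightarrow> T'" by blast
  have "(\<lambda>n. poly_op (P' n) A - poly_op (P n) A) \<longlonglongrightarrow> 0"
  proof (rule tendstoI)
    fix e :: real assume "0 < e"
    then have e3: "0 < e / 3" by simp
    have "\<forall>\<^sub>F n in sequentially. (\<forall>t\<in>real_spectrum A. dist (poly (P n) t) (f t) < e/3)
        \<and> (\<forall>t\<in>real_spectrum A. dist (poly (P' n) t) (f t) < e/3)"
      using uniform_limitD[OF ul e3] uniform_limitD[OF ul' e3] by (rule eventually_conj)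
    then show "\<forall>\<^sub>F n in sequentially. dist (poly_op (P' n) A - poly_op (P n) A) 0 < e"
    proof eventually_elim
      case (elim n)
      have "norm (poly_op (P' n) A - poly_op (P n) A) \<le> 2 * (e/3)"
      proof (rule norm_poly_op_diff_le[OF A])
        fix t assume t: "t \<in> real_spectrum A"
        show "\<bar>poly (P' n) t - poly (P n) t\<bar> \<le> 2 * (e/3)"
          using bspec[OF conjunct1[OF elim] t] bspec[OF conjunct2[OF elim] t]
          unfolding dist_real_def by linarith
      qed (use \<open>0 < e\<close> in simp)
      then show ?case using \<open>0 < e\<close> by simp
    qed
  qed
  moreover have "(\<lambda>n. poly_op (P' n) A - poly_op (P n) A) \<longlonglongrightarrow> T' - T"
    by (intro tendsto_intros lim lim')
  ultimately have "T' - T = 0" by (rule LIMSEQ_unique[rotated])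
  then show "T' = T" by simp
qed

lemma uniform_polynomial_approximation:
  fixes f :: "real \<Rightarrow> real"
  assumes "continuous_on {m..M} f"
  shows "\<exists>P :: nat \<Rightarrow> real poly. uniform_limit {m..M} (\<lambda>n. poly (P n)) f sequentially"
proof -
  have "\<exists>P :: real poly. \<forall>t\<in>{m..M}. \<bar>f t - poly P t\<bar> < inverse (Suc n)" for n
  proof -
    obtain g where g: "real_polynomial_function g" "\<And>x. x \<in> {m..M} \<Longrightarrow> \<bar>f x - g x\<bar> < inverse (Suc n)"
      by (rule Stone_Weierstrass_real_polynomial_function[OF compact_Icc assms, of "inverse (Suc n)"])
        simp_all
    obtain a N where "g = (\<lambda>x. \<Sum>i\<le>N. a i * x ^ i)"
      using g(1) unfolding real_polynomial_function_iff_sum by blast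
    then have "g = poly (\<Sum>i\<le>N. monom (a i) i)"
      by (simp add: fun_eq_iff poly_sum poly_monom)
    then show ?thesis using g(2) by blast
  qed
  then obtain P :: "nat \<Rightarrow> real poly"
    where P: "\<And>n t. t \<in> {m..M} \<Longrightarrow> \<bar>f t - poly (P n) t\<bar> < inverse (Suc n)"
    by metis
  have "uniform_limit {m..M} (\<lambda>n. poly (P n)) f sequentially"
  proof (rule uniform_limitI)
    fix e :: real assume "0 < e"
    then have "\<forall>\<^sub>F n in sequentially. inverse (real (Suc n)) < e"
      using LIMSEQ_inverse_real_of_nat by (simp add: order_tendsto_iff)
    then show "\<forall>\<^sub>F n in sequentially. \<forall>t\<in>{m..M}. dist (poly (P n) t) (f t) < e"
    proof eventually_elim
      case (elim n)
      show ?case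
      proof
        fix t assume "t \<in> {m..M}"
        from P[OF this, of n] elim show "dist (poly (P n) t) (f t) < e"
          by (simp only: dist_real_def abs_minus_commute[of "f t"])
      qed
    qed
  qed
  then show ?thesis by blast
qed

lemma poly_op_tendsto_fun_calc:
  assumes A: "A \<in> operator_interval m M"
    and ul: "uniform_limit {m..M} (\<lambda>n. poly (P n)) f sequentially"
  shows "(\<lambda>n. poly_op (P n) A) \<longlonglongrightarrow> fun_calc f A"
proof -
  note herm = operator_interval_hermitian[OF A]
  have ul': "uniform_limit (real_spectrum A) (\<lambda>n. poly (P n)) f sequentially"
    using ul real_spectrum_subset[OF A] by (rule uniform_limit_on_subset)
  have "Cauchy (\<lambda>n. poly_op (P n) A)"
  proof (rule CauchyI)
    fix e :: real assume "0 < e"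
    then have "0 < e / 3" by simp
    from uniform_limitD[OF ul' this] obtain N
      where N: "\<And>n t. n \<ge> N \<Longrightarrow> t \<in> real_spectrum A \<Longrightarrow> \<bar>poly (P n) t - f t\<bar> < e/3"
      unfolding eventually_sequentially dist_real_def by blast
    have "norm (poly_op (P k) A - poly_op (P n) A) < e" if kn: "k \<ge> N" "n \<ge> N" for k n
    proof -
      have "norm (poly_op (P k) A - poly_op (P n) A) \<le> 2 * (e/3)"
      proof (rule norm_poly_op_diff_le[OF herm])
        fix t assume t: "t \<in> real_spectrum A"
        show "\<bar>poly (P k) t - poly (P n) t\<bar> \<le> 2 * (e/3)"
          using N[OF kn(1) t] N[OF kn(2) t] by linarith
      qed (use \<open>0 < e\<close> in simp)
      then show ?thesis using \<open>0 < e\<close> by simp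
    qed
    then show "\<exists>N. \<forall>k\<ge>N. \<forall>n\<ge>N. norm (poly_op (P k) A - poly_op (P n) A) < e" by blast
  qed
  then obtain T where T: "(\<lambda>n. poly_op (P n) A) \<longlonglongrightarrow> T"
    using Cauchy_convergent_iff convergent_def by blast
  then show ?thesis using fun_calc_eqI[OF herm ul' T] by simp
qed

lemma fun_calc_cong:
  assumes A: "A \<in> operator_interval m M" and eq: "\<And>t. t \<in> {m..M} \<Longrightarrow> f t = g t"
  shows "fun_calc f A = fun_calc g A"
proof -
  have "uniform_limit (real_spectrum A) h f sequentially \<longleftrightarrow> uniform_limit (real_spectrum A) h g sequentially"
    for h :: "nat \<Rightarrow> real \<Rightarrow> real"
    using real_spectrum_subset[OF A] eq by (intro uniform_limit_cong') auto
  then show ?thesis unfolding fun_calc_def by simp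
qed

lemma fun_calc_poly: "A \<in> operator_interval m M \<Longrightarrow> fun_calc (poly P) A = poly_op P A"
  by (rule fun_calc_eqI[of A "\<lambda>_. P"]) (simp_all add: operator_interval_hermitian uniform_limit_const)

lemma fun_calc_const: "A \<in> operator_interval m M \<Longrightarrow> fun_calc (\<lambda>_. c) A = c *\<^sub>R id_blinfun"
  using fun_calc_poly[of A m M "[:c:]"] by (simp add: poly_op_const fun_eq_iff[of "poly [:c:]" "\<lambda>_. c", THEN iffD2])

lemma fun_calc_ident: "A \<in> operator_interval m M \<Longrightarrow> fun_calc (\<lambda>t. t) A = A"
  using fun_calc_poly[of A m M "[:0, 1:]"]
  by (simp add: poly_op_X fun_eq_iff[of "poly [:0, 1:]" "\<lambda>t. t", THEN iffD2])

context
  fixes A :: "'a::complex_hilbert \<Rightarrow>\<^sub>L 'a" and m M :: real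
  assumes A: "A \<in> operator_interval m M"
begin

lemma hermitian_fun_calc:
  assumes "continuous_on {m..M} f"
  shows "fun_calc f A \<in> hermitian"
proof -
  obtain P :: "nat \<Rightarrow> real poly" where "uniform_limit {m..M} (\<lambda>n. poly (P n)) f sequentially"
    using uniform_polynomial_approximation[OF assms] by blast
  from poly_op_tendsto_fun_calc[OF A this] show ?thesis
    by (rule hermitian_limit)
      (simp_all add: hermitian_poly_op operator_interval_hermitian[OF A])
qed

lemma fun_calc_add:
  assumes "continuous_on {m..M} f" "continuous_on {m..M} g"
  shows "fun_calc (\<lambda>t. f t + g t) A = fun_calc f A + fun_calc g A"
proof -
  obtain P Q :: "nat \<Rightarrow> real poly" where P: "uniform_limit {m..M} (\<lambda>n. poly (P n)) f sequentially"
    and Q: "uniform_limit {m..M} (\<lambda>n. poly (Q n)) g sequentially"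
    using assms[THEN uniform_polynomial_approximation] by blast
  have "uniform_limit {m..M} (\<lambda>n. poly (P n + Q n)) (\<lambda>t. f t + g t) sequentially"
    using uniform_limit_add[OF P Q] by (simp only: poly_add[abs_def])
  from poly_op_tendsto_fun_calc[OF A this]
  have "(\<lambda>n. poly_op (P n) A + poly_op (Q n) A) \<longlonglongrightarrow> fun_calc (\<lambda>t. f t + g t) A"
    by (simp only: poly_op_add)
  moreover have "(\<lambda>n. poly_op (P n) A + poly_op (Q n) A) \<longlonglongrightarrow> fun_calc f A + fun_calc g A"
    by (intro tendsto_add poly_op_tendsto_fun_calc[OF A] P Q)
  ultimately show ?thesis by (rule LIMSEQ_unique)
qed

lemma fun_calc_mult:
  assumes cont: "continuous_on {m..M} f" "continuous_on {m..M} g"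
  shows "fun_calc (\<lambda>t. f t * g t) A = fun_calc f A o\<^sub>L fun_calc g A"
proof -
  obtain P Q :: "nat \<Rightarrow> real poly" where P: "uniform_limit {m..M} (\<lambda>n. poly (P n)) f sequentially"
    and Q: "uniform_limit {m..M} (\<lambda>n. poly (Q n)) g sequentially"
    using cont[THEN uniform_polynomial_approximation] by blast
  have "bounded (f ` {m..M})" "bounded (g ` {m..M})"
    using cont by (auto intro!: compact_imp_bounded compact_continuous_image)
  then have "uniform_limit {m..M} (\<lambda>n. poly (P n * Q n)) (\<lambda>t. f t * g t) sequentially"
    using uniform_lim_mult[OF P Q] by (simp only: poly_mult[abs_def])
  from poly_op_tendsto_fun_calc[OF A this]
  have "(\<lambda>n. poly_op (P n) A o\<^sub>L poly_op (Q n) A) \<longlonglongrightarrow> fun_calc (\<lambda>t. f t * g t) A"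
    by (simp only: poly_op_mult)
  moreover have "(\<lambda>n. poly_op (P n) A o\<^sub>L poly_op (Q n) A) \<longlonglongrightarrow> (fun_calc f A o\<^sub>L fun_calc g A)"
    by (intro bounded_bilinear.tendsto[OF bounded_bilinear_blinfun_compose] poly_op_tendsto_fun_calc[OF A] P Q)
  ultimately show ?thesis by (rule LIMSEQ_unique)
qed

lemma fun_calc_scale:
  assumes "continuous_on {m..M} f"
  shows "fun_calc (\<lambda>t. c * f t) A = c *\<^sub>R fun_calc f A"
  using fun_calc_mult[OF continuous_on_const assms, of c] fun_calc_const[OF A, of c]
  by (simp add: bounded_bilinear.scaleR_left[OF bounded_bilinear_blinfun_compose])

lemma fun_calc_diff:
  assumes "continuous_on {m..M} f" "continuous_on {m..M} g"
  shows "fun_calc (\<lambda>t. f t - g t) A = fun_calc f A - fun_calc g A"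
proof -
  have "fun_calc (\<lambda>t. f t + (-1) * g t) A = fun_calc f A + fun_calc (\<lambda>t. (-1) * g t) A"
    by (intro fun_calc_add assms continuous_intros)
  then show ?thesis
    unfolding fun_calc_scale[OF assms(2)] by simp
qed

lemma norm_fun_calc_le:
  assumes cont: "continuous_on {m..M} f" and "0 \<le> r" and bound: "\<And>t. t \<in> {m..M} \<Longrightarrow> \<bar>f t\<bar> \<le> r"
  shows "norm (fun_calc f A) \<le> r"
proof (rule field_le_epsilon)
  fix e :: real assume "0 < e"
  obtain P :: "nat \<Rightarrow> real poly" where P: "uniform_limit {m..M} (\<lambda>n. poly (P n)) f sequentially"
    using uniform_polynomial_approximation[OF cont] by blast
  have "\<forall>\<^sub>F n in sequentially. norm (poly_op (P n) A) \<le> r + e"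
    using uniform_limitD[OF P \<open>0 < e\<close>]
  proof eventually_elim
    case (elim n)
    show ?case
    proof (rule norm_poly_op_le[OF operator_interval_hermitian[OF A]])
      fix t assume "t \<in> real_spectrum A"
      then have t: "t \<in> {m..M}" using real_spectrum_subset[OF A] by blast
      show "\<bar>poly (P n) t\<bar> \<le> r + e"
        using bound[OF t] bspec[OF elim t] unfolding dist_real_def by linarith
    qed (use \<open>0 \<le> r\<close> \<open>0 < e\<close> in simp)
  qed
  then show "norm (fun_calc f A) \<le> r + e"
    by (rule tendsto_upperbound[OF tendsto_norm[OF poly_op_tendsto_fun_calc[OF A P]] _ trivial_limit_sequentially])
qed

lemma norm_fun_calc_diff_le:
  assumes cont: "continuous_on {m..M} f" "continuous_on {m..M} g" and "0 \<le> r"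
    and bound: "\<And>t. t \<in> {m..M} \<Longrightarrow> \<bar>f t - g t\<bar> \<le> r"
  shows "norm (fun_calc f A - fun_calc g A) \<le> r"
  unfolding fun_calc_diff[OF cont, symmetric]
  by (intro norm_fun_calc_le continuous_intros cont \<open>0 \<le> r\<close> bound)

text \<open>
\<open>f(A)\<close> is the square of the Hermitian operator \<open>\<surd>f(A)\<close>.
\<close>

lemma fun_calc_nonneg:
  assumes cont: "continuous_on {m..M} f" and nonneg: "\<And>t. t \<in> {m..M} \<Longrightarrow> 0 \<le> f t"
  shows "0 \<le> x \<bullet> fun_calc f A x"
proof -
  let ?R = "fun_calc (\<lambda>t. sqrt (f t)) A"
  have cs: "continuous_on {m..M} (\<lambda>t. sqrt (f t))" by (intro continuous_intros cont)
  have "fun_calc f A = fun_calc (\<lambda>t. sqrt (f t) * sqrt (f t)) A"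
    by (rule fun_calc_cong[OF A]) (simp add: nonneg)
  also have "\<dots> = ?R o\<^sub>L ?R" by (rule fun_calc_mult[OF cs cs])
  finally have "x \<bullet> fun_calc f A x = ?R x \<bullet> ?R x"
    by (simp add: hermitian_inner[OF hermitian_fun_calc[OF cs]])
  then show ?thesis by simp
qed

lemma fun_calc_interval:
  assumes cont: "continuous_on {m..M} f" and range: "\<And>t. t \<in> {m..M} \<Longrightarrow> f t \<in> {m'..M'}"
  shows "fun_calc f A \<in> operator_interval m' M'"
proof -
  have "0 \<le> x \<bullet> (fun_calc f A - m' *\<^sub>R id_blinfun) x" for x
    unfolding fun_calc_const[OF A, symmetric] fun_calc_diff[OF cont continuous_on_const, symmetric]
    by (rule fun_calc_nonneg) (use range in \<open>auto intro!: continuous_intros cont\<close>)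
  moreover have "0 \<le> x \<bullet> (M' *\<^sub>R id_blinfun - fun_calc f A) x" for x
    unfolding fun_calc_const[OF A, symmetric] fun_calc_diff[OF continuous_on_const cont, symmetric]
    by (rule fun_calc_nonneg) (use range in \<open>auto intro!: continuous_intros cont\<close>)
  ultimately show ?thesis
    using hermitian_fun_calc[OF cont]
    by (simp add: operator_interval_def blinfun.diff_left blinfun.scaleR_left inner_diff_right power2_norm_eq_inner)
qed

lemma fun_calc_tendsto_uniform:
  assumes cont: "\<And>i. continuous_on {m..M} (h i)" "continuous_on {m..M} f"
    and ul: "uniform_limit {m..M} h f F"
  shows "((\<lambda>i. fun_calc (h i) A) \<longlongrightarrow> fun_calc f A) F"
proof (rule tendstoI)
  fix e :: real assume "0 < e"
  then have "0 < e / 2" by simp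
  from uniform_limitD[OF ul this] show "\<forall>\<^sub>F i in F. dist (fun_calc (h i) A) (fun_calc f A) < e"
  proof eventually_elim
    case (elim i)
    have "norm (fun_calc (h i) A - fun_calc f A) \<le> e / 2"
      by (rule norm_fun_calc_diff_le[OF cont])
        (use elim \<open>0 < e\<close> in \<open>auto simp: dist_real_def intro: less_imp_le\<close>)
    then show ?case using \<open>0 < e\<close> by (simp add: dist_norm)
  qed
qed

text \<open>
For a polynomial \<open>g\<close> this is multiplicativity; uniform approximation of \<open>g\<close> on the range of \<open>f\<close>
gives the rest.
\<close>

lemma fun_calc_compose:
  assumes cont: "continuous_on {m..M} f" and range: "\<And>t. t \<in> {m..M} \<Longrightarrow> f t \<in> {m'..M'}"
    and contg: "continuous_on {m'..M'} g"
  shows "fun_calc g (fun_calc f A) = fun_calc (\<lambda>t. g (f t)) A"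
proof -
  have B: "fun_calc f A \<in> operator_interval m' M'"
    using cont range by (rule fun_calc_interval)
  have pcont: "continuous_on {m..M} (\<lambda>t. poly P (f t))" for P :: "real poly"
    by (intro continuous_intros cont)
  have poly: "poly_op P (fun_calc f A) = fun_calc (\<lambda>t. poly P (f t)) A" for P
  proof (induction P)
    case 0
    then show ?case using fun_calc_const[OF A, of 0] by (simp add: poly_op_0)
  next
    case (pCons a P)
    have "fun_calc (\<lambda>t. a + f t * poly P (f t)) A
        = fun_calc (\<lambda>_. a) A + fun_calc (\<lambda>t. f t * poly P (f t)) A"
      by (intro fun_calc_add continuous_intros cont)
    then show ?case
      using pCons by (simp add: poly_op_pCons fun_calc_const[OF A] fun_calc_mult[OF cont pcont])
  qed
  obtain P :: "nat \<Rightarrow> real poly" where P: "uniform_limit {m'..M'} (\<lambda>n. poly (P n)) g sequentially"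
    using uniform_polynomial_approximation[OF contg] by blast
  have "(\<lambda>n. poly_op (P n) (fun_calc f A)) \<longlonglongrightarrow> fun_calc g (fun_calc f A)"
    by (rule poly_op_tendsto_fun_calc[OF B P])
  moreover have "(\<lambda>n. poly_op (P n) (fun_calc f A)) \<longlonglongrightarrow> fun_calc (\<lambda>t. g (f t)) A"
    unfolding poly
  proof (rule fun_calc_tendsto_uniform[OF pcont])
    show "continuous_on {m..M} (\<lambda>t. g (f t))"
      using range by (intro continuous_on_compose2[OF contg cont]) auto
    show "uniform_limit {m..M} (\<lambda>n t. poly (P n) (f t)) (\<lambda>t. g (f t)) sequentially"
      by (rule uniform_limit_compose'[OF P]) (use range in auto)
  qed
  ultimately show ?thesis by (rule LIMSEQ_unique)
qed

end

lemma tendsto_poly_op: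
  assumes "(X \<longlongrightarrow> T) F"
  shows "((\<lambda>i. poly_op P (X i)) \<longlongrightarrow> poly_op P T) F"
proof (induction P)
  case 0
  then show ?case by (simp add: poly_op_0)
next
  case (pCons a P)
  then show ?case
    unfolding poly_op_pCons
    by (intro tendsto_add tendsto_const bounded_bilinear.tendsto[OF bounded_bilinear_blinfun_compose] assms)
qed

text \<open>
Polynomials are norm continuous, and \<open>f\<close> is uniformly close to one on an interval that
serves all the operators involved.
\<close>

lemma tendsto_fun_calc:
  fixes T :: "'a::complex_hilbert \<Rightarrow>\<^sub>L 'a"
  assumes lim: "(X \<longlongrightarrow> T) F" and ev: "\<forall>\<^sub>F i in F. X i \<in> operator_interval m M"
    and T: "T \<in> operator_interval m M" and cont: "continuous_on {m..M} f"
  shows "((\<lambda>i. fun_calc f (X i)) \<longlongrightarrow> fun_calc f T) F"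
proof (rule tendstoI)
  fix e :: real assume "0 < e"
  then have e3: "0 < e / 3" by simp
  obtain P :: "nat \<Rightarrow> real poly" where P: "uniform_limit {m..M} (\<lambda>n. poly (P n)) f sequentially"
    using uniform_polynomial_approximation[OF cont] by blast
  obtain n where "\<And>t. t \<in> {m..M} \<Longrightarrow> dist (poly (P n) t) (f t) < e / 3"
    using eventually_happens'[OF sequentially_bot uniform_limitD[OF P e3]] by blast
  then have n: "\<And>t. t \<in> {m..M} \<Longrightarrow> \<bar>f t - poly (P n) t\<bar> \<le> e / 3"
    by (simp add: dist_real_def abs_minus_commute less_imp_le)
  have approx: "norm (fun_calc f B - poly_op (P n) B) \<le> e / 3" if "B \<in> operator_interval m M" for B :: "'a \<Rightarrow>\<^sub>L 'a"
    unfolding fun_calc_poly[OF that, symmetric]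
    by (rule norm_fun_calc_diff_le[OF that cont]) (use n e3 in \<open>auto intro!: continuous_intros\<close>)
  from ev tendstoD[OF tendsto_poly_op[OF lim, of "P n"] e3]
  show "\<forall>\<^sub>F i in F. dist (fun_calc f (X i)) (fun_calc f T) < e"
  proof eventually_elim
    case (elim i)
    have split: "fun_calc f (X i) - fun_calc f T = (fun_calc f (X i) - poly_op (P n) (X i))
        + (poly_op (P n) (X i) - poly_op (P n) T) - (fun_calc f T - poly_op (P n) T)"
      by simp
    have "norm (fun_calc f (X i) - fun_calc f T) \<le> norm (fun_calc f (X i) - poly_op (P n) (X i))
        + norm (poly_op (P n) (X i) - poly_op (P n) T) + norm (fun_calc f T - poly_op (P n) T)"
      unfolding split by (rule order_trans[OF norm_triangle_ineq4 add_right_mono[OF norm_triangle_ineq]])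
    then show ?case
      using approx[OF elim(1)] approx[OF T] elim(2) unfolding dist_norm by linarith
  qed
qed

section \<open>Positive definite operators and their powers\<close>

text \<open>
Positivity of the form at \<open>\<parallel>T\<parallel> x - T x\<close>.  As a consequence, near-minimisers of the form of a
positive operator are nearly in its kernel.
\<close>

lemma norm_square_le_quadratic_form:
  assumes T: "T \<in> hermitian" and psd: "\<And>x. 0 \<le> x \<bullet> T x"
  shows "(norm (T x))\<^sup>2 \<le> norm T * (x \<bullet> T x)"
proof (cases "T = 0")
  case True
  then show ?thesis by simp
next
  case False
  define K where "K = norm T"
  have K: "0 < K" using False by (simp add: K_def)
  have "T (T x) \<bullet> T x \<le> norm (T (T x)) * norm (T x)" by (rule norm_cauchy_schwarz)
  also have "\<dots> \<le> (K * norm (T x)) * norm (T x)"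
    unfolding K_def by (rule mult_right_mono[OF norm_blinfun]) simp
  finally have TT: "T x \<bullet> T (T x) \<le> K * (norm (T x))\<^sup>2"
    by (simp add: power2_eq_square inner_commute ac_simps)
  have "0 \<le> (K *\<^sub>R x - T x) \<bullet> T (K *\<^sub>R x - T x)" by (rule psd)
  also have "\<dots> = K * K * (x \<bullet> T x) - 2 * K * (norm (T x))\<^sup>2 + T x \<bullet> T (T x)"
    using hermitian_inner[OF T, of x "T x"]
    by (simp add: blinfun.diff_right blinfun.scaleR_right inner_diff_left inner_diff_right
        power2_norm_eq_inner right_diff_distrib)
  also have "\<dots> \<le> K * (K * (x \<bullet> T x) - (norm (T x))\<^sup>2)"
    using TT by (simp add: algebra_simps)
  finally show ?thesis using K by (simp add: zero_le_mult_iff K_def)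
qed

lemma operator_interval_mono:
  assumes "A \<in> operator_interval m M" "m' \<le> m" "M \<le> M'"
  shows "A \<in> operator_interval m' M'"
proof -
  have "m' * (norm x)\<^sup>2 \<le> m * (norm x)\<^sup>2" "M * (norm x)\<^sup>2 \<le> M' * (norm x)\<^sup>2" for x :: 'a
    using assms(2,3) by (auto intro: mult_right_mono)
  then show ?thesis
    using assms(1) unfolding operator_interval_def by (blast intro: order_trans)
qed

lemma hermitian_operator_interval:
  assumes "A \<in> hermitian"
  shows "A \<in> operator_interval (- norm A) (norm A)"
proof -
  have "\<bar>x \<bullet> A x\<bar> \<le> norm A * (norm x)\<^sup>2" for x
  proof -
    have "\<bar>x \<bullet> A x\<bar> \<le> norm x * norm (A x)" by (rule Cauchy_Schwarz_ineq2)
    also have "\<dots> \<le> norm x * (norm A * norm x)" by (rule mult_left_mono[OF norm_blinfun]) simp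
    finally show ?thesis by (simp add: power2_eq_square ac_simps)
  qed
  then show ?thesis using assms by (simp add: operator_interval_def abs_le_iff minus_le_iff)
qed

lemma operator_interval_pos_def:
  assumes A: "A \<in> operator_interval m M" and m: "0 < m"
  shows "A \<in> \<P>"
proof -
  have herm: "A \<in> hermitian" using A by (rule operator_interval_hermitian)
  have coercive: "m * (norm x)\<^sup>2 \<le> x \<bullet> A x" for x using A by (simp add: operator_interval_def)
  moreover have "0 \<le> m * (norm x)\<^sup>2" for x :: 'a using m by simp
  ultimately have "pos_semidef A"
    using herm unfolding pos_semidef_iff by (blast intro: order_trans)
  moreover have "invertible_op A"
    by (rule coercive_invertible[OF hermitian_bounded_ops[OF herm] m coercive])
  ultimately show ?thesis by (simp add: pos_def_def)
qed

lemma pos_def_hermitian: "A \<in> \<P> \<Longrightarrow> A \<in> hermitian"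
  and pos_def_nonneg: "A \<in> \<P> \<Longrightarrow> 0 \<le> x \<bullet> A x"
  by (simp_all add: pos_def_def pos_semidef_iff)

text \<open>
A positive operator with a bounded inverse has a positive lower bound:
\<open>\<parallel>x\<parallel>\<^sup>2 \<le> \<parallel>A\<^bsup>-1\<^esup>\<parallel>\<^sup>2 \<parallel>A x\<parallel>\<^sup>2 \<le> \<parallel>A\<^bsup>-1\<^esup>\<parallel>\<^sup>2 \<parallel>A\<parallel> \<langle>x, A x\<rangle>\<close>.  The two norms are increased by one so that the
constant does not vanish on the zero space.
\<close>

lemma pos_def_operator_interval:
  assumes A: "A \<in> \<P>"
  obtains m M where "0 < m" "m \<le> M" "A \<in> operator_interval m M"
proof -
  note herm = pos_def_hermitian[OF A]
  obtain S where "S o\<^sub>L A = id_blinfun"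
    using A by (auto simp: pos_def_def invertible_op_def inverse_ops_def)
  then have S: "S (A x) = x" for x by (metis blinfun_apply_blinfun_compose blinfun_apply_id_blinfun)
  define s where "s = (norm S + 1)\<^sup>2 * (norm A + 1)"
  have "0 < norm S + 1" "0 < norm A + 1" by (simp_all add: add_nonneg_pos)
  then have s: "0 < s" unfolding s_def by (intro mult_pos_pos zero_less_power)
  have "(norm x)\<^sup>2 \<le> s * (x \<bullet> A x)" for x
  proof -
    have "norm x \<le> norm S * norm (A x)" using norm_blinfun[of S "A x"] by (simp add: S)
    also have "\<dots> \<le> (norm S + 1) * norm (A x)" by (rule mult_right_mono) simp_all
    finally have "(norm x)\<^sup>2 \<le> (norm S + 1)\<^sup>2 * (norm (A x))\<^sup>2"
      by (metis norm_ge_zero power_mono power_mult_distrib)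
    also have "(norm (A x))\<^sup>2 \<le> (norm A + 1) * (x \<bullet> A x)"
      using norm_square_le_quadratic_form[OF herm pos_def_nonneg[OF A], of x] pos_def_nonneg[OF A, of x]
      by (simp add: distrib_right)
    finally show ?thesis
      by (simp add: s_def mult.assoc mult_left_mono)
  qed
  then have lo: "1 / s * (norm x)\<^sup>2 \<le> x \<bullet> A x" for x
    using s by (simp add: pos_divide_le_eq mult.commute)
  have "x \<bullet> A x \<le> norm A * (norm x)\<^sup>2" for x
    using hermitian_operator_interval[OF herm] by (simp add: operator_interval_def)
  with lo have "A \<in> operator_interval (1/s) (norm A)"
    using herm by (simp add: operator_interval_def)
  then have "A \<in> operator_interval (1/s) (max (1/s) (norm A))"
    by (rule operator_interval_mono) simp_all
  then show thesis by (rule that[rotated 2]) (use s in simp_all)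
qed

lemma pos_def_family_operator_interval:
  assumes "finite J" "\<And>j. j \<in> J \<Longrightarrow> A j \<in> \<P>"
  shows "\<exists>m M. 0 < m \<and> m \<le> M \<and> (\<forall>j\<in>J. A j \<in> operator_interval m M)"
  using assms
proof (induction J)
  case empty
  show ?case by (rule exI[of _ 1], rule exI[of _ 1]) simp
next
  case (insert i J)
  then obtain m M where J: "0 < m" "m \<le> M" "\<forall>j\<in>J. A j \<in> operator_interval m M" by blast
  obtain m' M' where i: "0 < m'" "m' \<le> M'" "A i \<in> operator_interval m' M'"
    using insert.prems by (blast elim: pos_def_operator_interval)
  have "\<forall>j\<in>insert i J. A j \<in> operator_interval (min m m') (max M M')"
    using J(3) i(3) by (auto elim!: operator_interval_mono)
  moreover have "0 < min m m'" "min m m' \<le> max M M'" using J i by auto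
  ultimately show ?case by blast
qed

lemma operator_interval_convex:
  assumes A: "\<And>j. j \<in> J \<Longrightarrow> A j \<in> operator_interval m M"
    and w: "\<And>j. j \<in> J \<Longrightarrow> 0 \<le> w j" "sum w J = 1"
  shows "(\<Sum>j\<in>J. w j *\<^sub>R A j) \<in> operator_interval m M"
proof -
  have ap: "x \<bullet> (\<Sum>j\<in>J. w j *\<^sub>R A j) x = (\<Sum>j\<in>J. w j * (x \<bullet> A j x))" for x
    by (simp add: blinfun.sum_left blinfun.scaleR_left inner_sum_right)
  have "(\<Sum>j\<in>J. w j * (m * (norm x)\<^sup>2)) \<le> x \<bullet> (\<Sum>j\<in>J. w j *\<^sub>R A j) x"
    "x \<bullet> (\<Sum>j\<in>J. w j *\<^sub>R A j) x \<le> (\<Sum>j\<in>J. w j * (M * (norm x)\<^sup>2))" for x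
    unfolding ap using A w by (auto intro!: sum_mono mult_left_mono simp: operator_interval_def)
  then show ?thesis
    using A w(2)
    by (simp add: operator_interval_def hermitian_sum hermitian_scaleR sum_distrib_right[symmetric])
qed

lemma pos_def_convex:
  assumes "finite J" "\<And>j. j \<in> J \<Longrightarrow> A j \<in> \<P>" "\<And>j. j \<in> J \<Longrightarrow> 0 \<le> w j" "sum w J = 1"
  shows "(\<Sum>j\<in>J. w j *\<^sub>R A j) \<in> \<P>"
proof -
  obtain m M where m: "0 < m" and A: "\<forall>j\<in>J. A j \<in> operator_interval m M"
    using pos_def_family_operator_interval[of J A] assms(1,2) by blast
  show ?thesis
    by (rule operator_interval_pos_def[OF operator_interval_convex[where m=m and M=M] m])
      (use A assms(3,4) in auto)
qed

lemma continuous_on_powr_Icc: "0 < m \<Longrightarrow> continuous_on {m..M} (\<lambda>t. t powr p)" for m M p :: real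
  by (intro continuous_intros) auto

lemma continuous_on_ln_Icc: "0 < m \<Longrightarrow> continuous_on {m..M} ln" for m M :: real
  by (intro continuous_on_ln continuous_on_id) auto

lemma powr_mem_Icc:
  fixes m M p t :: real
  assumes m: "0 < m" "m \<le> M" and t: "t \<in> {m..M}"
  shows "t powr p \<in> {min (m powr p) (M powr p)..max (m powr p) (M powr p)}"
proof (cases "0 \<le> p")
  case True
  then have "m powr p \<le> t powr p" "t powr p \<le> M powr p"
    using t m by (auto intro: powr_mono2)
  then show ?thesis by auto
next
  case False
  then have "M powr p \<le> t powr p" "t powr p \<le> m powr p"
    using t m by (auto intro: powr_mono2')
  then show ?thesis by auto
qed

lemma op_powr_operator_interval:
  assumes A: "A \<in> operator_interval m M" and m: "0 < m" and M: "m \<le> M"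
  shows "op_powr A p \<in> operator_interval (min (m powr p) (M powr p)) (max (m powr p) (M powr p))"
  unfolding op_powr_def
  by (rule fun_calc_interval[OF A continuous_on_powr_Icc[OF m] powr_mem_Icc[OF m M]])

lemma pos_def_op_powr: "A \<in> \<P> \<Longrightarrow> op_powr A p \<in> \<P>"
  by (erule pos_def_operator_interval, rule operator_interval_pos_def[OF op_powr_operator_interval])
    auto

lemma op_powr_add:
  assumes "A \<in> \<P>"
  shows "op_powr A p o\<^sub>L op_powr A q = op_powr A (p + q)"
proof -
  obtain m M where m: "0 < m" "m \<le> M" and A: "A \<in> operator_interval m M"
    using assms by (rule pos_def_operator_interval)
  show ?thesis
    unfolding op_powr_def fun_calc_mult[OF A continuous_on_powr_Icc continuous_on_powr_Icc, OF m(1) m(1), symmetric]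
    by (rule fun_calc_cong[OF A]) (simp add: powr_add)
qed

lemma op_powr_apply: "A \<in> \<P> \<Longrightarrow> op_powr A p (op_powr A q x) = op_powr A (p + q) x"
  by (metis op_powr_add blinfun_apply_blinfun_compose)

lemma op_powr_inner: "A \<in> \<P> \<Longrightarrow> op_powr A p x \<bullet> y = x \<bullet> op_powr A p y"
  by (simp add: hermitian_inner pos_def_hermitian pos_def_op_powr)

lemma op_powr_0:
  assumes "A \<in> \<P>"
  shows "op_powr A 0 = id_blinfun"
proof -
  obtain m M where m: "0 < m" and A: "A \<in> operator_interval m M"
    using assms by (rule pos_def_operator_interval)
  have "op_powr A 0 = fun_calc (\<lambda>_. 1) A"
    unfolding op_powr_def by (rule fun_calc_cong[OF A]) (use m in simp)
  then show ?thesis by (simp add: fun_calc_const[OF A])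
qed

lemma op_powr_1:
  assumes "A \<in> \<P>"
  shows "op_powr A 1 = A"
proof -
  obtain m M where m: "0 < m" and A: "A \<in> operator_interval m M"
    using assms by (rule pos_def_operator_interval)
  have "op_powr A 1 = fun_calc (\<lambda>t. t) A"
    unfolding op_powr_def by (rule fun_calc_cong[OF A]) (use m in simp)
  then show ?thesis by (simp add: fun_calc_ident[OF A])
qed

lemma op_powr_powr:
  assumes "A \<in> \<P>"
  shows "op_powr (op_powr A p) q = op_powr A (p * q)"
proof -
  obtain m M where m: "0 < m" "m \<le> M" and A: "A \<in> operator_interval m M"
    using assms by (rule pos_def_operator_interval)
  let ?l = "min (m powr p) (M powr p)" and ?u = "max (m powr p) (M powr p)"
  have "0 < ?l" using m by simp
  then have "fun_calc (\<lambda>t. t powr q) (fun_calc (\<lambda>t. t powr p) A) = fun_calc (\<lambda>t. (t powr p) powr q) A"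
    by (intro fun_calc_compose[OF A continuous_on_powr_Icc[OF m(1)] powr_mem_Icc[OF m]] continuous_on_powr_Icc)
  then show ?thesis by (simp add: op_powr_def powr_powr)
qed

lemma inverse_ops_op_powr:
  assumes "A \<in> \<P>"
  shows "inverse_ops A (op_powr A (-1))"
  using op_powr_add[OF assms, of 1 "-1"] op_powr_add[OF assms, of "-1" 1] assms
  by (intro inverse_opsI) (simp_all add: op_powr_0 op_powr_1 hermitian_bounded_ops pos_def_hermitian)

lemma op_inverse_eq_powr: "A \<in> \<P> \<Longrightarrow> op_inverse A = op_powr A (-1)"
  by (rule op_inverse_eqI[OF inverse_ops_op_powr])

lemma pos_def_sandwich:
  assumes "S \<in> \<P>" "T \<in> \<P>"
  shows "S o\<^sub>L T o\<^sub>L S \<in> \<P>"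
proof -
  have inv: "invertible_op S" "invertible_op T" using assms by (simp_all add: pos_def_def)
  have herm: "S \<in> hermitian" "T \<in> hermitian" using assms by (simp_all add: pos_def_hermitian)
  have bd: "S o\<^sub>L T \<in> bounded_ops"
    using herm[THEN hermitian_bounded_ops] by (simp add: bounded_ops_def)
  have "0 \<le> x \<bullet> (S o\<^sub>L T o\<^sub>L S) x" for x
    using pos_def_nonneg[OF assms(2), of "S x"] by (simp add: hermitian_inner[OF herm(1)])
  then show ?thesis
    using hermitian_sandwich[OF herm] inv bd herm[THEN hermitian_bounded_ops]
    by (simp add: pos_def_def pos_semidef_iff invertible_compose)
qed

section \<open>Operator monotonicity of the square root\<close>

text \<open>
This is \<open>Y\<^sup>2 \<le> S\<^sup>2 \<Longrightarrow> Y \<le> S\<close>.  Suppose that \<open>\<rho>\<close>, the supremum of the form of \<open>Y - S\<close> over unit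
vectors, is positive.  A unit vector \<open>y\<close> that nearly attains it is an approximate eigenvector,
so \<open>Y y\<close> is close to \<open>S y + \<rho> y\<close>.  As \<open>S\<close> is positive, \<open>\<parallel>S y + \<rho> y\<parallel>\<^sup>2 \<ge> \<parallel>S y\<parallel>\<^sup>2 + \<rho>\<^sup>2\<close>, which
contradicts \<open>\<parallel>Y y\<parallel> \<le> \<parallel>S y\<parallel>\<close>.
\<close>

lemma norm_le_imp_quadratic_form_le:
  fixes S Y :: "'a::complex_hilbert \<Rightarrow>\<^sub>L 'a"
  assumes S: "S \<in> hermitian" and psd: "\<And>x. 0 \<le> x \<bullet> S x" and Y: "Y \<in> hermitian"
    and le: "\<And>x. norm (Y x) \<le> norm (S x)"
  shows "x \<bullet> Y x \<le> x \<bullet> S x"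
proof (rule ccontr)
  define T where "T = Y - S"
  have T: "T \<in> hermitian" unfolding T_def by (rule hermitian_diff[OF Y S])
  assume "\<not> x \<bullet> Y x \<le> x \<bullet> S x"
  then have x: "0 < x \<bullet> T x" by (simp add: T_def blinfun.diff_left inner_diff_right)
  then have "x \<noteq> 0" by auto
  define \<Lambda> where "\<Lambda> = (\<lambda>y. y \<bullet> T y) ` {y. norm y = 1}"
  define \<rho> where "\<rho> = Sup \<Lambda>"
  have unit: "(y /\<^sub>R norm y) \<bullet> T (y /\<^sub>R norm y) = (y \<bullet> T y) / (norm y)\<^sup>2" for y
    by (simp add: blinfun.scaleR_right power2_eq_square field_simps)
  have unit_value: "(y \<bullet> T y) / (norm y)\<^sup>2 \<in> \<Lambda>" if "y \<noteq> 0" for y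
    unfolding \<Lambda>_def unit[symmetric] by (rule imageI) (use that in simp)
  have bdd: "bdd_above \<Lambda>"
  proof -
    have "y \<bullet> T y \<le> norm T * (norm y)\<^sup>2" for y
      using hermitian_operator_interval[OF T] by (simp add: operator_interval_def)
    then show ?thesis
      unfolding \<Lambda>_def
    proof (intro bdd_aboveI2[where M = "norm T"])
      fix y :: 'a assume "y \<in> {y. norm y = 1}"
      then show "y \<bullet> T y \<le> norm T" using \<open>\<And>y. y \<bullet> T y \<le> norm T * (norm y)\<^sup>2\<close>[of y] by simp
    qed
  qed
  have upper: "y \<bullet> T y \<le> \<rho> * (norm y)\<^sup>2" for y
  proof (cases "y = 0")
    case False
    then have "(y \<bullet> T y) / (norm y)\<^sup>2 \<le> \<rho>"
      unfolding \<rho>_def by (rule cSup_upper[OF unit_value bdd])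
    then show ?thesis using False by (simp add: pos_divide_le_eq)
  qed simp
  have \<rho>: "0 < \<rho>"
  proof (rule ccontr)
    assume "\<not> 0 < \<rho>"
    then have "\<rho> * (norm x)\<^sup>2 \<le> 0" by (simp add: mult_nonpos_nonneg)
    then show False using upper[of x] x by linarith
  qed
  define V where "V = \<rho> *\<^sub>R id_blinfun - T"
  have V: "V \<in> hermitian" unfolding V_def by (intro hermitian_diff hermitian_scaleR hermitian_id T)
  have Vform: "y \<bullet> V y = \<rho> * (norm y)\<^sup>2 - y \<bullet> T y" for y
    by (simp add: V_def blinfun.diff_left blinfun.scaleR_left inner_diff_right power2_norm_eq_inner)
  have Vpsd: "0 \<le> y \<bullet> V y" for y using upper[of y] by (simp add: Vform)
  \<comment> \<open>\<open>\<delta>\<close> is small enough for \<open>2 \<parallel>S\<parallel> \<delta> + \<delta>\<^sup>2 < \<rho>\<^sup>2\<close>\<close>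
  define k where "k = 2 * norm S + 2"
  have k: "0 < k" by (simp add: k_def add_nonneg_pos)
  define \<delta> where "\<delta> = min 1 (\<rho>\<^sup>2 / k)"
  have \<delta>: "0 < \<delta>" "\<delta> \<le> 1" using \<rho> k by (simp_all add: \<delta>_def)
  have "\<delta> * k \<le> \<rho>\<^sup>2 / k * k"
    by (rule mult_right_mono) (use k in \<open>simp_all add: \<delta>_def\<close>)
  then have \<delta>_small: "\<delta> * k \<le> \<rho>\<^sup>2" using k by simp
  \<comment> \<open>coming this close to \<open>\<rho>\<close> makes the vector an eigenvector up to \<open>\<delta>\<close>\<close>
  define \<eta> where "\<eta> = \<delta>\<^sup>2 / (norm V + 1)"
  have \<eta>: "0 < \<eta>" using \<delta> by (simp add: \<eta>_def add_nonneg_pos)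
  have "\<Lambda> \<noteq> {}" using unit_value[OF \<open>x \<noteq> 0\<close>] by blast
  then have "\<exists>l\<in>\<Lambda>. \<rho> - \<eta> < l"
    using less_cSup_iff[OF _ bdd, of "\<rho> - \<eta>"] \<eta> by (simp add: \<rho>_def)
  then obtain y where y: "norm y = 1" and ylarge: "\<rho> - \<eta> < y \<bullet> T y"
    by (auto simp: \<Lambda>_def)
  have Vy: "norm (V y) \<le> \<delta>"
  proof (rule power2_le_imp_le)
    have "(norm (V y))\<^sup>2 \<le> norm V * (y \<bullet> V y)" by (rule norm_square_le_quadratic_form[OF V Vpsd])
    also have "\<dots> \<le> (norm V + 1) * \<eta>"
      using ylarge y Vpsd[of y] by (intro mult_mono) (simp_all add: Vform)
    also have "\<dots> = \<delta>\<^sup>2"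
      by (simp add: \<eta>_def add_nonneg_eq_0_iff)
    finally show "(norm (V y))\<^sup>2 \<le> \<delta>\<^sup>2" .
  qed (use \<delta> in simp)
  have yy: "y \<bullet> y = 1" using power2_norm_eq_inner[of y] y by simp
  have "S y + \<rho> *\<^sub>R y = Y y + V y"
    by (simp add: V_def T_def blinfun.diff_left blinfun.scaleR_left)
  then have "norm (S y + \<rho> *\<^sub>R y) \<le> norm (S y) + \<delta>"
    using norm_triangle_ineq[of "Y y" "V y"] le[of y] Vy by simp
  then have "(norm (S y + \<rho> *\<^sub>R y))\<^sup>2 \<le> (norm (S y) + \<delta>)\<^sup>2"
    by (rule power_mono) simp
  moreover have "(norm (S y + \<rho> *\<^sub>R y))\<^sup>2 = (norm (S y))\<^sup>2 + 2 * \<rho> * (y \<bullet> S y) + \<rho>\<^sup>2"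
    unfolding power2_norm_eq_inner inner_add_left inner_add_right inner_scaleR_left inner_scaleR_right
      inner_commute[of "S y" y] yy
    by (simp add: power2_eq_square distrib_left)
  moreover have "0 \<le> 2 * \<rho> * (y \<bullet> S y)" using \<rho> psd[of y] by simp
  ultimately have "\<rho>\<^sup>2 \<le> 2 * norm (S y) * \<delta> + \<delta>\<^sup>2"
    unfolding power2_sum by linarith
  also have "\<dots> \<le> 2 * norm S * \<delta> + 1 * \<delta>"
    unfolding power2_eq_square using norm_blinfun[of S y] \<delta> y by (intro add_mono mult_right_mono) simp_all
  also have "\<dots> < \<delta> * k"
    using \<delta> by (simp add: k_def algebra_simps)
  finally show False using \<delta>_small by simp
qed

lemma le_op_sqrt:
  assumes C: "C \<in> \<P>" and Y: "Y \<in> hermitian" and le: "\<And>x. (norm (Y x))\<^sup>2 \<le> x \<bullet> C x"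
  shows "x \<bullet> Y x \<le> x \<bullet> op_powr C (1/2) x"
proof (rule norm_le_imp_quadratic_form_le)
  note R = pos_def_op_powr[OF C, of "1/2"]
  show "op_powr C (1/2) \<in> hermitian" "0 \<le> y \<bullet> op_powr C (1/2) y" for y
    using R by (simp_all add: pos_def_hermitian pos_def_nonneg)
  fix y
  have "op_powr C (1/2) y \<bullet> op_powr C (1/2) y = y \<bullet> C y"
    by (simp add: op_powr_inner[OF C] op_powr_apply[OF C] op_powr_1[OF C])
  then have "(norm (Y y))\<^sup>2 \<le> (norm (op_powr C (1/2) y))\<^sup>2"
    using le[of y] by (simp only: power2_norm_eq_inner)
  then show "norm (Y y) \<le> norm (op_powr C (1/2) y)"
    by (rule power2_le_imp_le) simp
qed (rule Y)

section \<open>Operator concavity of powers\<close>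

lemma operator_interval_perturb:
  assumes T: "T \<in> operator_interval m M" and X: "X \<in> hermitian" and le: "norm (X - T) \<le> d"
  shows "X \<in> operator_interval (m - d) (M + d)"
proof -
  have "X - T \<in> hermitian"
    by (intro hermitian_diff X operator_interval_hermitian[OF T])
  then have "X - T \<in> operator_interval (- d) d"
    by (rule operator_interval_mono[OF hermitian_operator_interval]) (use le in auto)
  then show ?thesis
    using T X by (simp add: operator_interval_def blinfun.diff_left inner_diff_right distrib_right left_diff_distrib)
      (smt (verit))
qed

lemma tendsto_fun_calc_neighbourhood:
  assumes lim: "(X \<longlongrightarrow> T) F" and ev: "\<forall>\<^sub>F i in F. X i \<in> hermitian"
    and T: "T \<in> operator_interval m M" and d: "0 < d" and cont: "continuous_on {m - d..M + d} f"
  shows "((\<lambda>i. fun_calc f (X i)) \<longlongrightarrow> fun_calc f T) F"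
proof (rule tendsto_fun_calc[OF lim _ _ cont])
  show "T \<in> operator_interval (m - d) (M + d)"
    using T by (rule operator_interval_mono) (use d in simp_all)
  show "\<forall>\<^sub>F i in F. X i \<in> operator_interval (m - d) (M + d)"
    using ev tendstoD[OF lim d]
    by eventually_elim (auto intro: operator_interval_perturb[OF T] simp: dist_norm)
qed

lemma tendsto_op_powr:
  assumes lim: "(X \<longlongrightarrow> T) F" and ev: "\<forall>\<^sub>F i in F. X i \<in> hermitian" and T: "T \<in> \<P>"
  shows "((\<lambda>i. op_powr (X i) p) \<longlongrightarrow> op_powr T p) F"
proof -
  obtain m M where m: "0 < m" and T': "T \<in> operator_interval m M"
    using T by (rule pos_def_operator_interval)
  show ?thesis
    unfolding op_powr_def
    by (rule tendsto_fun_calc_neighbourhood[OF lim ev T', of "m/2"])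
      (use m in \<open>auto intro: continuous_on_powr_Icc\<close>)
qed

lemma tendsto_op_exp:
  assumes lim: "(X \<longlongrightarrow> T) F" and ev: "\<forall>\<^sub>F i in F. X i \<in> hermitian" and T: "T \<in> hermitian"
  shows "((\<lambda>i. op_exp (X i)) \<longlongrightarrow> op_exp T) F"
  unfolding op_exp_def
  by (rule tendsto_fun_calc_neighbourhood[OF lim ev hermitian_operator_interval[OF T], of 1])
    (auto intro!: continuous_intros)

lemma pos_def_op_exp:
  assumes "H \<in> hermitian"
  shows "op_exp H \<in> \<P>"
  unfolding op_exp_def
  by (rule operator_interval_pos_def[OF fun_calc_interval[OF hermitian_operator_interval[OF assms],
      where m' = "exp (- norm H)" and M' = "exp (norm H)"]])
    (auto intro!: continuous_intros)

lemma hermitian_op_log: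
  assumes "A \<in> \<P>"
  shows "op_log A \<in> hermitian"
  using assms unfolding op_log_def
  by (metis pos_def_operator_interval hermitian_fun_calc continuous_on_ln_Icc)

lemma op_powr_eq_exp:
  assumes "A \<in> \<P>"
  shows "op_powr A p = op_exp (p *\<^sub>R op_log A)"
proof -
  obtain m M where m: "0 < m" and A: "A \<in> operator_interval m M"
    using assms by (rule pos_def_operator_interval)
  have cont: "continuous_on {m..M} (\<lambda>t. p * ln t)"
    by (intro continuous_on_mult_left continuous_on_ln_Icc m)
  then have "bounded ((\<lambda>t. p * ln t) ` {m..M})"
    by (intro compact_imp_bounded compact_continuous_image compact_Icc)
  then obtain r where "\<forall>t\<in>{m..M}. \<bar>p * ln t\<bar> \<le> r"
    by (auto simp: bounded_iff)
  then have r: "\<bar>p * ln t\<bar> \<le> r" if "t \<in> {m..M}" for t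
    using that by blast
  have "op_exp (p *\<^sub>R op_log A) = fun_calc exp (fun_calc (\<lambda>t. p * ln t) A)"
    by (simp add: op_exp_def op_log_def fun_calc_scale[OF A continuous_on_ln_Icc[OF m]])
  also have "\<dots> = fun_calc (\<lambda>t. exp (p * ln t)) A"
    by (rule fun_calc_compose[OF A cont, where m' = "- r" and M' = r])
      (use r in \<open>auto intro!: continuous_intros simp: abs_le_iff minus_le_iff\<close>)
  also have "\<dots> = op_powr A p"
    unfolding op_powr_def by (rule fun_calc_cong[OF A]) (use m in \<open>simp add: powr_def\<close>)
  finally show ?thesis by simp
qed

lemma tendsto_op_powr_exponent:
  assumes "A \<in> \<P>"
  shows "((\<lambda>s. op_powr A s) \<longlongrightarrow> op_powr A a) (at a within S)"
  unfolding op_powr_eq_exp[OF assms]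
  by (intro tendsto_op_exp tendsto_intros always_eventually allI hermitian_scaleR hermitian_op_log assms)

text \<open>
Expand \<open>\<parallel>A\<^bsup>b/2\<^esup> x - A\<^bsup>a/2\<^esup> y\<parallel>\<^sup>2 \<ge> 0\<close>.
\<close>

lemma op_powr_young:
  assumes A: "A \<in> \<P>"
  shows "2 * (op_powr A ((a + b) / 2) x \<bullet> y) \<le> x \<bullet> op_powr A b x + y \<bullet> op_powr A a y"
proof -
  let ?u = "op_powr A (b/2) x" and ?v = "op_powr A (a/2) y"
  have sum: "a / 2 + b / 2 = (a + b) / 2" by simp
  have "0 \<le> (?u - ?v) \<bullet> (?u - ?v)" by simp
  also have "\<dots> = ?u \<bullet> ?u - 2 * (?v \<bullet> ?u) + ?v \<bullet> ?v"
    unfolding inner_diff_left inner_diff_right inner_commute[of ?u ?v] by simp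
  also have "?v \<bullet> ?u = y \<bullet> op_powr A ((a + b) / 2) x"
    unfolding op_powr_inner[OF A] op_powr_apply[OF A] sum ..
  also have "?u \<bullet> ?u = x \<bullet> op_powr A b x"
    by (simp add: op_powr_inner[OF A] op_powr_apply[OF A])
  also have "?v \<bullet> ?v = y \<bullet> op_powr A a y"
    by (simp add: op_powr_inner[OF A] op_powr_apply[OF A])
  finally show ?thesis by (simp add: inner_commute)
qed

text \<open>
For \<open>y = Y\<^bsup>-1\<^esup> v\<close> one has \<open>\<langle>v, Y\<^bsup>-1\<^esup> v\<rangle> = 2 \<langle>v, y\<rangle> - \<langle>y, Y y\<rangle> \<le> 2 \<langle>v, y\<rangle> - \<langle>y, X y\<rangle> \<le> \<langle>v, X\<^bsup>-1\<^esup> v\<rangle>\<close>.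
\<close>

lemma inverse_antimono:
  assumes X: "X \<in> \<P>" and Y: "Y \<in> \<P>" and le: "\<And>x. x \<bullet> X x \<le> x \<bullet> Y x"
  shows "v \<bullet> op_powr Y (-1) v \<le> v \<bullet> op_powr X (-1) v"
proof -
  let ?y = "op_powr Y (-1) v"
  have "Y ?y = v"
    using op_powr_apply[OF Y, of 1 "-1" v] by (simp add: op_powr_0 op_powr_1 Y)
  then have "2 * (v \<bullet> ?y) = v \<bullet> ?y + ?y \<bullet> Y ?y" by (simp add: inner_commute)
  moreover have "2 * (v \<bullet> ?y) \<le> v \<bullet> op_powr X (-1) v + ?y \<bullet> X ?y"
    using op_powr_young[OF X, of 1 "-1" v ?y] by (simp add: op_powr_0 op_powr_1 X)
  ultimately show ?thesis using le[of ?y] by linarith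
qed

text \<open>
Such a set contains the dyadic rationals of the unit interval.
\<close>

lemma unit_interval_subset_closed_midpoint:
  fixes E :: "real set"
  assumes closed: "closed E" and ends: "0 \<in> E" "1 \<in> E"
    and midpoint: "\<And>a b. a \<in> E \<Longrightarrow> b \<in> E \<Longrightarrow> (a + b) / 2 \<in> E"
  shows "{0..1} \<subseteq> E"
proof -
  have dyadic: "real i / 2 ^ k \<in> E" if "i \<le> 2 ^ k" for i k
    using that
  proof (induction k arbitrary: i)
    case 0
    then have "i = 0 \<or> i = 1" by auto
    then show ?case using ends by auto
  next
    case (Suc k)
    let ?a = "i div 2" and ?b = "i - i div 2"
    have "?a \<le> 2 ^ k" "?b \<le> 2 ^ k" using Suc.prems by auto
    then have "(real ?a / 2 ^ k + real ?b / 2 ^ k) / 2 \<in> E"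
      by (intro midpoint Suc.IH)
    moreover have "(real ?a / 2 ^ k + real ?b / 2 ^ k) / 2 = real i / 2 ^ Suc k"
      by (simp add: add_divide_distrib[symmetric] of_nat_diff)
    ultimately show ?case by (rule back_subst[of "\<lambda>t. t \<in> E"])
  qed
  have "closure ({0..1} \<inter> (\<Union>k i. {real i / 2 ^ k})) = closure {0..1::real}"
    by (rule closure_dyadic_rationals_in_convex_set_pos_1) (auto simp: interior_atLeastAtMost_real)
  moreover have "{0..1} \<inter> (\<Union>k i. {real i / 2 ^ k}) \<subseteq> E"
    using dyadic by (auto simp: pos_divide_le_eq)
  ultimately show ?thesis
    using closure_minimal[OF _ closed] by (metis closed_atLeastAtMost closure_closed)
qed

lemma quadratic_form_sum:
  fixes T :: "'i \<Rightarrow> 'a::real_inner \<Rightarrow>\<^sub>L 'a"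
  shows "x \<bullet> (\<Sum>j\<in>J. w j *\<^sub>R T j) x = (\<Sum>j\<in>J. w j * (x \<bullet> T j x))"
  by (simp add: blinfun.sum_left blinfun.scaleR_left inner_sum_right)

text \<open>
With \<open>D = \<Sum>\<^sub>j w\<^sub>j B\<^sub>j\<close> this is operator concavity of \<open>t\<^sup>s\<close>, and with a single operator \<open>B\<close> it is the
Loewner--Heinz inequality.  The exponents that satisfy the conclusion form a closed set which contains \<open>0\<close> and \<open>1\<close>,
so it is enough to pass from \<open>a\<close> and \<open>b\<close> to \<open>h = (a + b)/2\<close>.  Let \<open>G s = \<Sum>\<^sub>j w\<^sub>j B\<^sub>j\<^sup>s\<close>.
The inequalities for \<open>a\<close> and \<open>b\<close> yield \<open>G h D\<^bsup>-a\<^esup> G h \<le> D\<^sup>b\<close>.  Hence the square of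
\<open>D\<^bsup>-a/2\<^esup> G h D\<^bsup>-a/2\<^esup>\<close> is at most \<open>D\<^bsup>b-a\<^esup>\<close>; taking square roots and removing the outer factors
gives \<open>G h \<le> D\<^sup>h\<close>.
\<close>

lemma op_powr_concave:
  fixes B :: "'i \<Rightarrow> 'a::complex_hilbert \<Rightarrow>\<^sub>L 'a"
  assumes B: "\<And>j. j \<in> J \<Longrightarrow> B j \<in> \<P>" and D: "D \<in> \<P>"
    and w: "\<And>j. j \<in> J \<Longrightarrow> 0 \<le> w j" "sum w J \<le> 1"
    and le: "\<And>x. x \<bullet> (\<Sum>j\<in>J. w j *\<^sub>R B j) x \<le> x \<bullet> D x"
    and s: "0 \<le> s" "s \<le> 1"
  shows "x \<bullet> (\<Sum>j\<in>J. w j *\<^sub>R op_powr (B j) s) x \<le> x \<bullet> op_powr D s x"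
proof -
  define G where "G s = (\<Sum>j\<in>J. w j *\<^sub>R op_powr (B j) s)" for s
  define E where "E = {s. \<forall>x. x \<bullet> G s x \<le> x \<bullet> op_powr D s x}"
  have "closed E"
  proof -
    have "continuous_on UNIV (\<lambda>s. x \<bullet> G s x)" "continuous_on UNIV (\<lambda>s. x \<bullet> op_powr D s x)" for x
      unfolding continuous_on_def G_def using B D
      by (auto intro!: tendsto_intros tendsto_op_powr_exponent)
    then have "closed {s. x \<bullet> G s x \<le> x \<bullet> op_powr D s x}" for x
      by (rule closed_Collect_le)
    then show ?thesis unfolding E_def by (simp add: closed_Collect_all)
  qed
  moreover have "0 \<in> E"
  proof -
    have "x \<bullet> G 0 x = sum w J * (x \<bullet> x)" for x
      unfolding G_def quadratic_form_sum sum_distrib_right by (rule sum.cong) (simp_all add: op_powr_0 B)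
    also have "\<dots> x \<le> 1 * (x \<bullet> x)" for x
      by (rule mult_right_mono[OF w(2)]) simp
    finally show ?thesis by (simp add: E_def op_powr_0 D)
  qed
  moreover have "1 \<in> E"
    using le by (simp add: E_def G_def op_powr_1 B D)
  moreover have "(a + b) / 2 \<in> E" if a: "a \<in> E" and b: "b \<in> E" for a b
  proof -
    let ?h = "(a + b) / 2"
    have herm: "G ?h \<in> hermitian"
      unfolding G_def by (intro hermitian_sum hermitian_scaleR pos_def_hermitian pos_def_op_powr B)
    define Y where "Y = op_powr D (- a / 2) o\<^sub>L G ?h o\<^sub>L op_powr D (- a / 2)"
    have Y: "Y \<in> hermitian"
      unfolding Y_def by (intro hermitian_sandwich herm pos_def_hermitian pos_def_op_powr D)
    \<comment> \<open>maximising \<open>2 \<langle>G h x, y\<rangle> - \<langle>y, D\<^sup>a y\<rangle>\<close> over \<open>y\<close> gives the left-hand side; the maximiser is \<open>D\<^bsup>-a\<^esup> G h x\<close>\<close>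
    have schur: "G ?h x \<bullet> op_powr D (- a) (G ?h x) \<le> x \<bullet> op_powr D b x" for x
    proof -
      let ?y = "op_powr D (- a) (G ?h x)"
      have "op_powr D a ?y = G ?h x" by (simp add: op_powr_apply D op_powr_0)
      then have "?y \<bullet> op_powr D a ?y = G ?h x \<bullet> ?y" by (simp add: inner_commute)
      moreover have "?y \<bullet> G a ?y \<le> ?y \<bullet> op_powr D a ?y" using a by (simp add: E_def)
      moreover have "x \<bullet> G b x \<le> x \<bullet> op_powr D b x" using b by (simp add: E_def)
      moreover have "2 * (G ?h x \<bullet> ?y) \<le> x \<bullet> G b x + ?y \<bullet> G a ?y"
      proof -
        have "2 * (G ?h x \<bullet> ?y) = (\<Sum>j\<in>J. w j * (2 * (op_powr (B j) ?h x \<bullet> ?y)))"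
          by (simp add: G_def blinfun.sum_left blinfun.scaleR_left inner_sum_left sum_distrib_left ac_simps)
        also have "\<dots> \<le> (\<Sum>j\<in>J. w j * (x \<bullet> op_powr (B j) b x + ?y \<bullet> op_powr (B j) a ?y))"
          by (intro sum_mono mult_left_mono op_powr_young B w(1))
        also have "\<dots> = x \<bullet> G b x + ?y \<bullet> G a ?y"
          unfolding G_def quadratic_form_sum by (simp add: distrib_left sum.distrib)
        finally show ?thesis .
      qed
      ultimately show ?thesis by linarith
    qed
    have "norm (Y z) \<le> norm (op_powr D ((b - a) / 2) z)" for z
    proof (rule power2_le_imp_le)
      let ?x = "op_powr D (- a / 2) z"
      have Yz: "Y z = op_powr D (- a / 2) (G ?h ?x)" by (simp add: Y_def)
      have "(norm (Y z))\<^sup>2 = G ?h ?x \<bullet> op_powr D (- a) (G ?h ?x)"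
        unfolding power2_norm_eq_inner Yz by (simp add: op_powr_inner[OF D] op_powr_apply[OF D])
      also have "\<dots> \<le> ?x \<bullet> op_powr D b ?x" by (rule schur)
      also have "\<dots> = z \<bullet> op_powr D (b - a) z"
        by (simp add: op_powr_inner[OF D] op_powr_apply[OF D] add_divide_distrib[symmetric])
      also have "\<dots> = (norm (op_powr D ((b - a) / 2) z))\<^sup>2"
        unfolding power2_norm_eq_inner by (simp add: op_powr_inner[OF D] op_powr_apply[OF D])
      finally show "(norm (Y z))\<^sup>2 \<le> (norm (op_powr D ((b - a) / 2) z))\<^sup>2" .
    qed simp
    then have "z \<bullet> Y z \<le> z \<bullet> op_powr D ((b - a) / 2) z" for z
      by (intro norm_le_imp_quadratic_form_le Y pos_def_hermitian pos_def_nonneg pos_def_op_powr D)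
    have "x \<bullet> G ?h x \<le> x \<bullet> op_powr D ?h x" for x
    proof -
      let ?z = "op_powr D (a / 2) x"
      have "x \<bullet> G ?h x = ?z \<bullet> Y ?z"
        by (simp add: Y_def op_powr_inner[OF D] op_powr_apply[OF D] op_powr_0[OF D])
      also have "\<dots> \<le> ?z \<bullet> op_powr D ((b - a) / 2) ?z" by fact
      also have "\<dots> = x \<bullet> op_powr D (a / 2 + ((b - a) / 2 + a / 2)) x"
        by (simp only: op_powr_inner[OF D] op_powr_apply[OF D])
      also have "a / 2 + ((b - a) / 2 + a / 2) = ?h" by (simp add: field_simps)
      finally show ?thesis .
    qed
    then show ?thesis by (simp add: E_def)
  qed
  ultimately have "{0..1} \<subseteq> E" by (rule unit_interval_subset_closed_midpoint)
  then show ?thesis using s by (auto simp: E_def G_def)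
qed

lemma op_powr_mono:
  assumes B: "B \<in> \<P>" and D: "D \<in> \<P>" and le: "\<And>x. x \<bullet> B x \<le> x \<bullet> D x" and s: "0 \<le> s" "s \<le> 1"
  shows "x \<bullet> op_powr B s x \<le> x \<bullet> op_powr D s x"
  using op_powr_concave[of "{()}" "\<lambda>_. B" D "\<lambda>_. 1" s x] assms by simp

section \<open>The near-order\<close>

lemma near_le_iff:
  assumes X: "X \<in> \<P>" and Y: "Y \<in> \<P>"
  shows "X \<preceq> Y \<longleftrightarrow>
    (\<forall>x. x \<bullet> X x \<le> x \<bullet> op_powr (op_powr X (1/2) o\<^sub>L Y o\<^sub>L op_powr X (1/2)) (1/2) x)"
proof -
  let ?R = "op_powr (op_powr X (1/2) o\<^sub>L Y o\<^sub>L op_powr X (1/2)) (1/2)"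
  let ?N = "op_powr X (-1/2) o\<^sub>L ?R o\<^sub>L op_powr X (-1/2)"
  have G: "op_inverse X \<sharp> Y = ?N"
    by (simp add: geometric_mean_def op_inverse_eq_powr X op_powr_powr)
  have "?N \<in> \<P>" by (intro pos_def_op_powr pos_def_sandwich X Y)
  then have "id_blinfun \<le>\<^sub>L ?N \<longleftrightarrow> (\<forall>x. x \<bullet> x \<le> x \<bullet> ?N x)"
    by (simp add: loewner_le_iff hermitian_id pos_def_hermitian)
  also have "\<dots> \<longleftrightarrow> (\<forall>x. x \<bullet> X x \<le> x \<bullet> ?R x)"
  proof (intro iffI allI)
    fix x
    let ?z = "op_powr X (1/2) x"
    assume "\<forall>x. x \<bullet> x \<le> x \<bullet> ?N x"
    then have "?z \<bullet> ?z \<le> ?z \<bullet> ?N ?z" by blast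
    then show "x \<bullet> X x \<le> x \<bullet> ?R x"
      by (simp add: op_powr_inner[OF X] op_powr_apply[OF X] op_powr_0[OF X] op_powr_1[OF X])
  next
    fix x
    let ?z = "op_powr X (-1/2) x"
    assume "\<forall>x. x \<bullet> X x \<le> x \<bullet> ?R x"
    then have "?z \<bullet> op_powr X 1 ?z \<le> ?z \<bullet> ?R ?z" by (simp add: op_powr_1[OF X])
    then show "x \<bullet> x \<le> x \<bullet> ?N x"
      by (simp add: op_powr_inner[OF X] op_powr_apply[OF X] op_powr_0[OF X])
  qed
  finally show ?thesis by (simp add: near_le_def X Y G)
qed

text \<open>
From \<open>X \<le> Y\<close> follows \<open>X\<^sup>2 = X\<^bsup>1/2\<^esup> X X\<^bsup>1/2\<^esup> \<le> X\<^bsup>1/2\<^esup> Y X\<^bsup>1/2\<^esup>\<close>; take square roots.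
\<close>

lemma quadratic_form_le_imp_near_le:
  assumes X: "X \<in> \<P>" and Y: "Y \<in> \<P>" and le: "\<And>x. x \<bullet> X x \<le> x \<bullet> Y x"
  shows "X \<preceq> Y"
  unfolding near_le_iff[OF X Y]
proof (intro allI le_op_sqrt pos_def_sandwich pos_def_op_powr pos_def_hermitian X Y)
  fix x
  let ?u = "op_powr X (1/2) x"
  have "(norm (X x))\<^sup>2 = op_powr X 1 x \<bullet> op_powr X 1 x"
    by (simp add: power2_norm_eq_inner op_powr_1[OF X])
  also have "\<dots> = ?u \<bullet> op_powr X 1 ?u"
    by (simp add: op_powr_inner[OF X] op_powr_apply[OF X])
  also have "\<dots> \<le> ?u \<bullet> Y ?u" using le[of ?u] by (simp add: op_powr_1[OF X])
  also have "\<dots> = x \<bullet> (op_powr X (1/2) o\<^sub>L Y o\<^sub>L op_powr X (1/2)) x"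
    by (simp add: op_powr_inner[OF X])
  finally show "(norm (X x))\<^sup>2 \<le> x \<bullet> (op_powr X (1/2) o\<^sub>L Y o\<^sub>L op_powr X (1/2)) x" .
qed

text \<open>
This is a case of the Ando--Hiai inequality.  Let \<open>R = (X\<^bsup>1/2\<^esup> Y X\<^bsup>1/2\<^esup>)\<^bsup>1/2\<^esup>\<close>, so that \<open>X \<le> R\<close> by
assumption, and put \<open>Z = X\<^bsup>1/2\<^esup> R X\<^bsup>1/2\<^esup>\<close>.  Then \<open>X\<^sup>2 \<le> Z\<close>, and, using \<open>X \<le> R\<close> twice more,
\<open>Z\<^sup>2 = X\<^bsup>1/2\<^esup> R X R X\<^bsup>1/2\<^esup> \<le> X\<^bsup>1/2\<^esup> R\<^sup>3 X\<^bsup>1/2\<^esup> = X\<^bsup>1/2\<^esup> R\<^sup>2 R\<^bsup>-1\<^esup> R\<^sup>2 X\<^bsup>1/2\<^esup> \<le> X\<^bsup>1/2\<^esup> R\<^sup>2 X\<^bsup>-1\<^esup> R\<^sup>2 X\<^bsup>1/2\<^esup> = X Y\<^sup>2 X\<close>.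
Square roots give \<open>X\<^sup>2 \<le> Z \<le> (X Y\<^sup>2 X)\<^bsup>1/2\<^esup>\<close>.
\<close>

lemma near_le_square:
  assumes near: "X \<preceq> Y"
  shows "op_powr X 2 \<preceq> op_powr Y 2"
proof -
  have X: "X \<in> \<P>" and Y: "Y \<in> \<P>" using near by (simp_all add: near_le_def)
  have X1: "op_powr X 1 = X" by (rule op_powr_1[OF X])
  define C where "C = op_powr X (1/2) o\<^sub>L Y o\<^sub>L op_powr X (1/2)"
  define R where "R = op_powr C (1/2)"
  have C: "C \<in> \<P>" unfolding C_def by (intro pos_def_sandwich pos_def_op_powr X Y)
  have R: "R \<in> \<P>" unfolding R_def by (rule pos_def_op_powr[OF C])
  have RR: "R (R x) = C x" for x
    by (simp add: R_def op_powr_apply C op_powr_1)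
  have R_inner: "R x \<bullet> y = x \<bullet> R y" for x y
    by (rule hermitian_inner[OF pos_def_hermitian[OF R]])
  have le: "x \<bullet> X x \<le> x \<bullet> R x" for x
    using near unfolding near_le_iff[OF X Y] R_def C_def by blast
  have half: "op_powr (op_powr X 2) (1/2) = X" by (simp add: op_powr_powr X op_powr_1)
  define Z where "Z = op_powr X (1/2) o\<^sub>L R o\<^sub>L op_powr X (1/2)"
  have Z: "Z \<in> hermitian"
    unfolding Z_def by (intro hermitian_sandwich pos_def_hermitian pos_def_op_powr X R)
  have "x \<bullet> op_powr X 2 x \<le> x \<bullet> Z x" for x
  proof -
    let ?u = "op_powr X (1/2) x"
    have "x \<bullet> op_powr X 2 x = ?u \<bullet> op_powr X 1 ?u"
      by (simp add: op_powr_inner[OF X] op_powr_apply[OF X])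
    also have "\<dots> \<le> ?u \<bullet> R ?u" unfolding X1 by (rule le)
    also have "\<dots> = x \<bullet> Z x" by (simp add: Z_def op_powr_inner[OF X])
    finally show ?thesis .
  qed
  also have "x \<bullet> Z x \<le> x \<bullet> op_powr (X o\<^sub>L op_powr Y 2 o\<^sub>L X) (1/2) x" for x
  proof (rule le_op_sqrt[OF pos_def_sandwich[OF X pos_def_op_powr[OF Y]] Z])
    fix x
    let ?u = "op_powr X (1/2) x"
    let ?v = "R (R ?u)"
    have "(norm (Z x))\<^sup>2 = R ?u \<bullet> op_powr X 1 (R ?u)"
      by (simp add: power2_norm_eq_inner Z_def op_powr_inner[OF X] op_powr_apply[OF X])
    also have "\<dots> \<le> R ?u \<bullet> R (R ?u)" unfolding X1 by (rule le)
    also have "\<dots> = ?v \<bullet> op_powr R (-1) ?v"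
      using op_powr_apply[OF R, of "-1" 1 "R ?u"]
      by (simp add: op_powr_1 op_powr_0 R R_inner)
    also have "\<dots> \<le> ?v \<bullet> op_powr X (-1) ?v"
      by (rule inverse_antimono[OF X R le])
    also have "\<dots> = op_powr X (-1/2) ?v \<bullet> op_powr X (-1/2) ?v"
      by (simp add: op_powr_inner[OF X] op_powr_apply[OF X])
    also have "op_powr X (-1/2) ?v = Y (X x)"
      by (simp add: RR C_def op_powr_apply[OF X] op_powr_0[OF X] X1)
    also have "Y (X x) \<bullet> Y (X x) = x \<bullet> (X o\<^sub>L op_powr Y 2 o\<^sub>L X) x"
      using op_powr_inner[OF Y, of 1 "X x"] op_powr_apply[OF Y, of 1 1]
      by (simp add: op_powr_1[OF Y] hermitian_inner[OF pos_def_hermitian[OF X], symmetric])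
    finally show "(norm (Z x))\<^sup>2 \<le> x \<bullet> (X o\<^sub>L op_powr Y 2 o\<^sub>L X) x" .
  qed
  finally show ?thesis
    by (simp add: near_le_iff pos_def_op_powr X Y half)
qed

lemma near_le_of_dyadic_power:
  assumes X: "X \<in> \<P>" and Y: "Y \<in> \<P>" and near: "op_powr X (1 / 2 ^ k) \<preceq> op_powr Y (1 / 2 ^ k)"
  shows "X \<preceq> Y"
  using near
proof (induction k)
  case 0
  then show ?case by (simp add: op_powr_1 X Y)
next
  case (Suc k)
  from near_le_square[OF Suc.prems] show ?case
    by (intro Suc.IH) (simp add: op_powr_powr X Y)
qed

text \<open>
In the form of \<open>near_le_iff\<close> the near-order involves only products and square roots, which are norm
continuous at positive definite limits.
\<close>

lemma near_le_limit:
  assumes X: "(X \<longlongrightarrow> X') F" "X' \<in> \<P>" and Y: "(Y \<longlongrightarrow> Y') F" "Y' \<in> \<P>"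
    and nontriv: "F \<noteq> bot" and ev: "\<forall>\<^sub>F i in F. X i \<preceq> Y i"
  shows "X' \<preceq> Y'"
  unfolding near_le_iff[OF X(2) Y(2)]
proof
  fix x
  let ?C = "\<lambda>X Y. op_powr X (1/2) o\<^sub>L Y o\<^sub>L op_powr X (1/2)"
  have evX: "\<forall>\<^sub>F i in F. X i \<in> hermitian"
    using ev by eventually_elim (simp add: near_le_def pos_def_hermitian)
  have evC: "\<forall>\<^sub>F i in F. ?C (X i) (Y i) \<in> hermitian"
    using ev by eventually_elim (simp add: near_le_def pos_def_hermitian pos_def_sandwich pos_def_op_powr)
  have "((\<lambda>i. ?C (X i) (Y i)) \<longlongrightarrow> ?C X' Y') F"
    by (intro bounded_bilinear.tendsto[OF bounded_bilinear_blinfun_compose] tendsto_op_powr X Y evX)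
  then have "((\<lambda>i. op_powr (?C (X i) (Y i)) (1/2)) \<longlongrightarrow> op_powr (?C X' Y') (1/2)) F"
    by (rule tendsto_op_powr[OF _ evC]) (intro pos_def_sandwich pos_def_op_powr X Y)
  then have "((\<lambda>i. x \<bullet> op_powr (?C (X i) (Y i)) (1/2) x) \<longlongrightarrow> x \<bullet> op_powr (?C X' Y') (1/2) x) F"
    by (intro tendsto_intros)
  moreover have "((\<lambda>i. x \<bullet> X i x) \<longlongrightarrow> x \<bullet> X' x) F"
    by (intro tendsto_intros X)
  moreover have "\<forall>\<^sub>F i in F. x \<bullet> X i x \<le> x \<bullet> op_powr (?C (X i) (Y i)) (1/2) x"
    using ev
  proof eventually_elim
    case (elim i)
    then have "X i \<in> \<P>" "Y i \<in> \<P>" by (simp_all add: near_le_def)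
    from near_le_iff[OF this] elim show ?case by blast
  qed
  ultimately show "x \<bullet> X' x \<le> x \<bullet> op_powr (?C X' Y') (1/2) x"
    by (intro tendsto_le[OF nontriv])
qed

section \<open>Quasi-arithmetic means\<close>

text \<open>
Filling the gap of a difference quotient by the derivative gives a continuous function.  Applied to \<open>exp\<close>
and \<open>ln\<close>, it lets the functional calculus factor \<open>e\<^sup>u - 1 = u h(u)\<close> and \<open>ln t = (t - 1) g(t)\<close>; both
limits below then follow from norm continuity alone, without remainder estimates.
\<close>

lemma continuous_on_difference_quotient:
  fixes f f' :: "real \<Rightarrow> real"
  assumes deriv: "\<And>x. x \<in> S \<Longrightarrow> (f has_real_derivative f' x) (at x)" and a: "a \<in> S"
  shows "continuous_on S (\<lambda>x. if x = a then f' a else (f x - f a) / (x - a))" (is "continuous_on S ?g")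
proof (intro continuous_at_imp_continuous_on ballI)
  fix x assume x: "x \<in> S"
  show "isCont ?g x"
  proof (cases "x = a")
    case True
    have "((\<lambda>x. (f x - f a) / (x - a)) \<longlongrightarrow> f' a) (at a)"
      using deriv[OF a] by (simp add: has_field_derivative_iff)
    then have "(?g \<longlongrightarrow> f' a) (at a)"
      by (rule Lim_transform_eventually) (simp add: eventually_at_filter)
    then show ?thesis using True by (simp add: isCont_def)
  next
    case False
    then have "\<forall>\<^sub>F y in nhds x. y \<noteq> a" by (rule t1_space_nhds)
    then have "\<forall>\<^sub>F y in nhds x. ?g y = (f y - f a) / (y - a)" by eventually_elim simp
    moreover have "isCont (\<lambda>y. (f y - f a) / (y - a)) x"
      using False DERIV_isCont[OF deriv[OF x]] by (intro continuous_intros) auto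
    ultimately show ?thesis by (simp add: isCont_cong)
  qed
qed

lemma fun_calc_scalar:
  fixes c :: real
  assumes "continuous_on {c..c} f"
  shows "fun_calc f (c *\<^sub>R id_blinfun :: 'a::complex_hilbert \<Rightarrow>\<^sub>L 'a) = f c *\<^sub>R id_blinfun"
proof -
  have I: "(c *\<^sub>R id_blinfun :: 'a \<Rightarrow>\<^sub>L 'a) \<in> operator_interval c c"
    by (simp add: operator_interval_def hermitian_scaleR hermitian_id blinfun.scaleR_left power2_norm_eq_inner)
  have "fun_calc f (c *\<^sub>R id_blinfun :: 'a \<Rightarrow>\<^sub>L 'a) = fun_calc (\<lambda>_. f c) (c *\<^sub>R id_blinfun)"
    by (rule fun_calc_cong[OF I]) simp
  then show ?thesis by (simp add: fun_calc_const[OF I])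
qed

lemma tendsto_op_exp_difference_quotient:
  assumes H: "H \<in> hermitian"
  shows "((\<lambda>r. (1 / r) *\<^sub>R (op_exp (r *\<^sub>R H) - id_blinfun)) \<longlongrightarrow> H) (at 0)"
proof -
  define h :: "real \<Rightarrow> real" where "h u = (if u = 0 then exp 0 else (exp u - exp 0) / (u - 0))" for u
  have "continuous_on UNIV h"
    unfolding h_def by (rule continuous_on_difference_quotient) (auto intro!: derivative_eq_intros)
  then have h: "continuous_on S h" for S by (rule continuous_on_subset) simp
  have factor: "op_exp K = id_blinfun + (K o\<^sub>L fun_calc h K)" if "K \<in> hermitian" for K :: "'a \<Rightarrow>\<^sub>L 'a"
  proof -
    note K = hermitian_operator_interval[OF that]
    have "op_exp K = fun_calc (\<lambda>u. 1 + u * h u) K"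
      unfolding op_exp_def by (rule fun_calc_cong[OF K]) (simp add: h_def)
    also have "\<dots> = fun_calc (\<lambda>_. 1) K + (fun_calc (\<lambda>u. u) K o\<^sub>L fun_calc h K)"
      by (simp add: fun_calc_add[OF K] fun_calc_mult[OF K] h continuous_on_mult continuous_on_id)
    finally show ?thesis by (simp add: fun_calc_const[OF K] fun_calc_ident[OF K])
  qed
  have "((\<lambda>r. r *\<^sub>R H) \<longlongrightarrow> 0 *\<^sub>R H) (at 0)"
    by (intro tendsto_intros)
  then have "((\<lambda>r. r *\<^sub>R H) \<longlongrightarrow> 0) (at 0)" by simp
  then have "((\<lambda>r. fun_calc h (r *\<^sub>R H)) \<longlongrightarrow> fun_calc h 0) (at 0)"
    by (rule tendsto_fun_calc_neighbourhood[OF _ _ hermitian_operator_interval[OF hermitian_zero] zero_less_one h])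
      (simp add: hermitian_scaleR H)
  moreover have "fun_calc h 0 = (id_blinfun :: 'a \<Rightarrow>\<^sub>L 'a)"
    using fun_calc_scalar[OF h, of 0] by (simp add: h_def)
  ultimately have "((\<lambda>r. H o\<^sub>L fun_calc h (r *\<^sub>R H)) \<longlongrightarrow> (H o\<^sub>L id_blinfun)) (at 0)"
    by (intro bounded_bilinear.tendsto[OF bounded_bilinear_blinfun_compose] tendsto_const) simp
  then have "((\<lambda>r. H o\<^sub>L fun_calc h (r *\<^sub>R H)) \<longlongrightarrow> H) (at 0)" by simp
  then show ?thesis
  proof (rule Lim_transform_eventually)
    show "\<forall>\<^sub>F r in at 0. (H o\<^sub>L fun_calc h (r *\<^sub>R H)) = (1 / r) *\<^sub>R (op_exp (r *\<^sub>R H) - id_blinfun)"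
      unfolding eventually_at_filter
      by (simp add: factor hermitian_scaleR H
          bounded_bilinear.scaleR_left[OF bounded_bilinear_blinfun_compose])
  qed
qed

lemma tendsto_op_log_difference_quotient:
  assumes lim: "((\<lambda>r. (1 / r) *\<^sub>R (S r - id_blinfun)) \<longlongrightarrow> L) (at 0)"
    and S: "(S \<longlongrightarrow> id_blinfun) (at 0)" "\<And>r. S r \<in> \<P>"
  shows "((\<lambda>r. (1 / r) *\<^sub>R op_log (S r)) \<longlongrightarrow> L) (at 0)"
proof -
  define g :: "real \<Rightarrow> real" where "g t = (if t = 1 then inverse 1 else (ln t - ln 1) / (t - 1))" for t
  have "continuous_on {0<..} g"
    unfolding g_def by (rule continuous_on_difference_quotient) (auto intro!: derivative_eq_intros simp: inverse_eq_divide)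
  then have g: "continuous_on {m..M} g" if "0 < m" for m M
    by (rule continuous_on_subset) (use that in auto)
  have factor: "op_log A = (A - id_blinfun) o\<^sub>L fun_calc g A" if pd: "A \<in> \<P>" for A :: "'a \<Rightarrow>\<^sub>L 'a"
  proof -
    obtain m M where m: "0 < m" and A: "A \<in> operator_interval m M"
      using pd by (rule pos_def_operator_interval)
    have "op_log A = fun_calc (\<lambda>t. (t - 1) * g t) A"
      unfolding op_log_def by (rule fun_calc_cong[OF A]) (simp add: g_def)
    also have "\<dots> = fun_calc (\<lambda>t. t - 1) A o\<^sub>L fun_calc g A"
      by (intro fun_calc_mult[OF A] g m continuous_intros)
    also have "fun_calc (\<lambda>t. t - 1) A = A - id_blinfun"
      by (simp add: fun_calc_diff[OF A continuous_on_id continuous_on_const] fun_calc_const[OF A] fun_calc_ident[OF A])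
    finally show ?thesis .
  qed
  have I: "(id_blinfun :: 'a \<Rightarrow>\<^sub>L 'a) \<in> operator_interval 1 1"
    by (simp add: operator_interval_def hermitian_id power2_norm_eq_inner)
  have "((\<lambda>r. fun_calc g (S r)) \<longlongrightarrow> fun_calc g id_blinfun) (at 0)"
    by (rule tendsto_fun_calc_neighbourhood[OF S(1) _ I, of "1/2"])
      (simp_all add: S(2) pos_def_hermitian g)
  moreover have "fun_calc g id_blinfun = (id_blinfun :: 'a \<Rightarrow>\<^sub>L 'a)"
    using fun_calc_scalar[OF g, of 1] by (simp add: g_def)
  ultimately have "((\<lambda>r. (1 / r) *\<^sub>R (S r - id_blinfun) o\<^sub>L fun_calc g (S r)) \<longlongrightarrow> (L o\<^sub>L id_blinfun)) (at 0)"
    by (intro bounded_bilinear.tendsto[OF bounded_bilinear_blinfun_compose] lim) simp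
  then show ?thesis
    by (simp add: factor S(2) bounded_bilinear.scaleR_left[OF bounded_bilinear_blinfun_compose])
qed

context
  fixes n :: nat and w :: "nat \<Rightarrow> real" and A :: "nat \<Rightarrow> ('a::complex_hilbert \<Rightarrow>\<^sub>L 'a)"
  assumes pos_def_tuple: "\<forall>j\<in>{1..n}. A j \<in> \<P>" and w: "w \<in> \<Delta> n"
begin

lemma tuple_pos_def: "j \<in> {1..n} \<Longrightarrow> A j \<in> \<P>"
  using pos_def_tuple by blast

definition power_sum :: "real \<Rightarrow> 'a \<Rightarrow>\<^sub>L 'a" where
  "power_sum p = (\<Sum>j=1..n. w j *\<^sub>R op_powr (A j) p)"

lemma weights: "j \<in> {1..n} \<Longrightarrow> 0 \<le> w j" "sum w {1..n} = 1"
  using w by (auto simp: prob_vectors_def less_imp_le)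

lemma pos_def_power_sum: "power_sum p \<in> \<P>"
  unfolding power_sum_def by (intro pos_def_convex pos_def_op_powr tuple_pos_def weights finite_atLeastAtMost)

lemma quasi_mean_nonzero_eq: "quasi_mean_nonzero p n w A = op_powr (power_sum p) (1 / p)"
  by (simp add: quasi_mean_nonzero_def power_sum_def)

lemma pos_def_quasi_mean_nonzero: "quasi_mean_nonzero p n w A \<in> \<P>"
  unfolding quasi_mean_nonzero_eq by (intro pos_def_op_powr pos_def_power_sum)

lemma hermitian_weighted_log: "(\<Sum>j=1..n. w j *\<^sub>R op_log (A j)) \<in> hermitian"
  by (intro hermitian_sum hermitian_scaleR hermitian_op_log tuple_pos_def)

lemma pos_def_log_euclidean_mean: "log_euclidean_mean n w A \<in> \<P>"
  unfolding log_euclidean_mean_def by (intro pos_def_op_exp hermitian_weighted_log)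

text \<open>
Since \<open>Q\<^sub>r = exp ((1/r) log S\<^sub>r)\<close>, the exponent has to converge to \<open>\<Sum>\<^sub>j w\<^sub>j log A\<^sub>j\<close>.  This is the
derivative of \<open>S\<^sub>r\<close> at \<open>r = 0\<close>, where \<open>S\<^sub>0\<close> is the identity, and there the logarithm has derivative one.
\<close>

lemma quasi_mean_tendsto_log_euclidean:
  "((\<lambda>r. quasi_mean_nonzero r n w A) \<longlongrightarrow> log_euclidean_mean n w A) (at 0)"
proof -
  have sum_id: "(\<Sum>j=1..n. w j *\<^sub>R (id_blinfun :: 'a \<Rightarrow>\<^sub>L 'a)) = id_blinfun"
    by (simp only: scaleR_sum_left[symmetric] weights(2) scaleR_one)
  have "(power_sum \<longlongrightarrow> power_sum 0) (at 0)"
    unfolding power_sum_def by (intro tendsto_intros tendsto_op_powr_exponent tuple_pos_def)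
  moreover have "power_sum 0 = (\<Sum>j=1..n. w j *\<^sub>R (id_blinfun :: 'a \<Rightarrow>\<^sub>L 'a))"
    unfolding power_sum_def by (rule sum.cong) (simp_all add: op_powr_0 tuple_pos_def)
  ultimately have S: "(power_sum \<longlongrightarrow> id_blinfun) (at 0)" by (simp only: sum_id)
  have "((\<lambda>r. \<Sum>j=1..n. w j *\<^sub>R ((1 / r) *\<^sub>R (op_exp (r *\<^sub>R op_log (A j)) - id_blinfun)))
      \<longlongrightarrow> (\<Sum>j=1..n. w j *\<^sub>R op_log (A j))) (at 0)"
    by (intro tendsto_intros tendsto_op_exp_difference_quotient hermitian_op_log tuple_pos_def)
  moreover have "(\<Sum>j=1..n. w j *\<^sub>R ((1 / r) *\<^sub>R (op_exp (r *\<^sub>R op_log (A j)) - id_blinfun)))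
      = (1 / r) *\<^sub>R (power_sum r - id_blinfun)" for r
  proof -
    have "power_sum r - id_blinfun = (\<Sum>j=1..n. w j *\<^sub>R (op_powr (A j) r - id_blinfun))"
      unfolding scaleR_diff_right sum_subtractf sum_id power_sum_def ..
    also have "\<dots> = (\<Sum>j=1..n. w j *\<^sub>R (op_exp (r *\<^sub>R op_log (A j)) - id_blinfun))"
      by (rule sum.cong) (simp_all add: op_powr_eq_exp tuple_pos_def)
    finally show ?thesis by (simp add: scaleR_sum_right mult.commute)
  qed
  ultimately have "((\<lambda>r. (1 / r) *\<^sub>R (power_sum r - id_blinfun)) \<longlongrightarrow> (\<Sum>j=1..n. w j *\<^sub>R op_log (A j))) (at 0)"
    by simp
  then have "((\<lambda>r. (1 / r) *\<^sub>R op_log (power_sum r)) \<longlongrightarrow> (\<Sum>j=1..n. w j *\<^sub>R op_log (A j))) (at 0)"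
    by (rule tendsto_op_log_difference_quotient[OF _ S pos_def_power_sum])
  then show ?thesis
    unfolding quasi_mean_nonzero_eq log_euclidean_mean_def op_powr_eq_exp[OF pos_def_power_sum]
    by (intro tendsto_op_exp hermitian_weighted_log always_eventually allI hermitian_scaleR hermitian_op_log pos_def_power_sum)
qed

lemma quasi_mean_0: "quasi_mean 0 n w A = log_euclidean_mean n w A"
  using tendsto_Lim[OF _ quasi_mean_tendsto_log_euclidean] by (simp add: quasi_mean_def)

text \<open>
Both parts are one argument, carried out for the orders \<open>c p\<close> and \<open>c q\<close> with \<open>c = 1\<close>
or \<open>c = -1\<close>: concavity with exponent \<open>p/q\<close>, then monotonicity with exponent \<open>t/p\<close>.
\<close>

lemma power_sum_powr_mono:
  assumes t: "0 \<le> t" "t \<le> p" and p: "0 < p" "p \<le> q"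
  shows "x \<bullet> op_powr (power_sum p) (t / p) x \<le> x \<bullet> op_powr (power_sum q) (t / q) x"
    and "x \<bullet> op_powr (power_sum (- p)) (t / p) x \<le> x \<bullet> op_powr (power_sum (- q)) (t / q) x"
proof -
  have mono: "x \<bullet> op_powr (power_sum (c * p)) (t / p) x \<le> x \<bullet> op_powr (power_sum (c * q)) (t / q) x" for c x
  proof -
    have "x \<bullet> power_sum (c * p) x \<le> x \<bullet> op_powr (power_sum (c * q)) (p / q) x" for x
    proof -
      have "power_sum (c * p) = (\<Sum>j=1..n. w j *\<^sub>R op_powr (op_powr (A j) (c * q)) (p / q))"
        unfolding power_sum_def using p by (intro sum.cong refl) (simp add: op_powr_powr tuple_pos_def)
      moreover have "x \<bullet> (\<Sum>j=1..n. w j *\<^sub>R op_powr (op_powr (A j) (c * q)) (p / q)) x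
          \<le> x \<bullet> op_powr (power_sum (c * q)) (p / q) x"
      proof (rule op_powr_concave)
        show "x \<bullet> (\<Sum>j=1..n. w j *\<^sub>R op_powr (A j) (c * q)) x \<le> x \<bullet> power_sum (c * q) x" for x
          by (simp only: power_sum_def order_refl)
        show "op_powr (A j) (c * q) \<in> \<P>" if "j \<in> {1..n}" for j
          by (rule pos_def_op_powr[OF tuple_pos_def[OF that]])
      qed (use p in \<open>simp_all add: pos_def_power_sum weights del: One_nat_def\<close>)
      ultimately show ?thesis by (simp only:)
    qed
    then have "x \<bullet> op_powr (power_sum (c * p)) (t / p) x \<le> x \<bullet> op_powr (op_powr (power_sum (c * q)) (p / q)) (t / p) x"
      using op_powr_mono[OF pos_def_power_sum pos_def_op_powr[OF pos_def_power_sum], of "c * p" "c * q" "p / q" "t / p" x] t p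
      by simp
    then show ?thesis using p by (simp add: op_powr_powr pos_def_power_sum)
  qed
  show "x \<bullet> op_powr (power_sum p) (t / p) x \<le> x \<bullet> op_powr (power_sum q) (t / q) x"
    using mono[of x 1] by simp
  show "x \<bullet> op_powr (power_sum (- p)) (t / p) x \<le> x \<bullet> op_powr (power_sum (- q)) (t / q) x"
    using mono[of x "- 1"] by simp
qed

text \<open>
Any dyadic \<open>t \<le> p\<close> reduces the claim to a Loewner inequality between the \<open>t\<close>-th powers of the means.
For negative orders these powers are the inverses of the operators in \<open>power_sum_powr_mono\<close>.
\<close>

lemma quasi_mean_nonzero_near_mono:
  assumes p: "0 < p" "p \<le> q"
  shows "quasi_mean_nonzero p n w A \<preceq> quasi_mean_nonzero q n w A"
    and "quasi_mean_nonzero (- q) n w A \<preceq> quasi_mean_nonzero (- p) n w A"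
proof -
  obtain k where "(1 / 2) ^ k < p"
    using real_arch_pow_inv[OF p(1), of "1/2"] by auto
  define t :: real where "t = 1 / 2 ^ k"
  have t: "0 \<le> t" "t \<le> p" using \<open>(1 / 2) ^ k < p\<close> by (simp_all add: t_def power_one_over)
  have pw: "op_powr (quasi_mean_nonzero r n w A) t = op_powr (power_sum r) (t / r)" for r
    by (simp add: quasi_mean_nonzero_eq op_powr_powr pos_def_power_sum)
  have "op_powr (quasi_mean_nonzero p n w A) t \<preceq> op_powr (quasi_mean_nonzero q n w A) t"
    unfolding pw
    by (intro quadratic_form_le_imp_near_le pos_def_op_powr pos_def_power_sum power_sum_powr_mono t p)
  then show "quasi_mean_nonzero p n w A \<preceq> quasi_mean_nonzero q n w A"
    unfolding t_def
    by (rule near_le_of_dyadic_power[OF pos_def_quasi_mean_nonzero pos_def_quasi_mean_nonzero])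
  have "op_powr (quasi_mean_nonzero (- r) n w A) t = op_powr (op_powr (power_sum (- r)) (t / r)) (- 1)" for r
    unfolding pw by (simp add: op_powr_powr[OF pos_def_power_sum])
  then have "op_powr (quasi_mean_nonzero (- q) n w A) t \<preceq> op_powr (quasi_mean_nonzero (- p) n w A) t"
    by (simp only:) (intro quadratic_form_le_imp_near_le inverse_antimono pos_def_op_powr pos_def_power_sum
        power_sum_powr_mono t p)
  then show "quasi_mean_nonzero (- q) n w A \<preceq> quasi_mean_nonzero (- p) n w A"
    unfolding t_def
    by (rule near_le_of_dyadic_power[OF pos_def_quasi_mean_nonzero pos_def_quasi_mean_nonzero])
qed

lemma log_euclidean_near:
  assumes q: "0 < q"
  shows "log_euclidean_mean n w A \<preceq> quasi_mean_nonzero q n w A"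
    and "quasi_mean_nonzero (- q) n w A \<preceq> log_euclidean_mean n w A"
proof -
  have ev: "\<forall>\<^sub>F r in at_right 0. 0 < r \<and> r \<le> q"
    using eventually_at_right_less[of 0] eventually_at_right_real[OF q]
    by eventually_elim auto
  have lim: "((\<lambda>r. quasi_mean_nonzero r n w A) \<longlongrightarrow> log_euclidean_mean n w A) (at_right 0)"
    by (rule tendsto_within_subset[OF quasi_mean_tendsto_log_euclidean]) simp
  have lim': "((\<lambda>r. quasi_mean_nonzero (- r) n w A) \<longlongrightarrow> log_euclidean_mean n w A) (at_right 0)"
  proof (rule filterlim_compose[OF quasi_mean_tendsto_log_euclidean])
    show "filterlim uminus (at 0) (at_right (0::real))"
      unfolding filterlim_at by (auto intro!: tendsto_eq_intros simp: eventually_at_filter)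
  qed
  show "log_euclidean_mean n w A \<preceq> quasi_mean_nonzero q n w A"
    by (rule near_le_limit[OF lim pos_def_log_euclidean_mean tendsto_const pos_def_quasi_mean_nonzero])
      (use ev in \<open>auto elim!: eventually_mono intro: quasi_mean_nonzero_near_mono\<close>)
  show "quasi_mean_nonzero (- q) n w A \<preceq> log_euclidean_mean n w A"
    by (rule near_le_limit[OF tendsto_const pos_def_quasi_mean_nonzero lim' pos_def_log_euclidean_mean])
      (use ev in \<open>auto elim!: eventually_mono intro: quasi_mean_nonzero_near_mono\<close>)
qed

lemma arithmetic_mean_eq: "arithmetic_mean n w A = quasi_mean 1 n w A"
proof -
  have "power_sum 1 = arithmetic_mean n w A"
    unfolding power_sum_def arithmetic_mean_def by (rule sum.cong) (simp_all add: op_powr_1 tuple_pos_def)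
  then show ?thesis
    using op_powr_1[OF pos_def_power_sum, of 1] by (simp add: quasi_mean_def quasi_mean_nonzero_eq)
qed

lemma harmonic_mean_eq: "harmonic_mean n w A = quasi_mean (- 1) n w A"
proof -
  have "power_sum (- 1) = (\<Sum>j=1..n. w j *\<^sub>R op_inverse (A j))"
    unfolding power_sum_def by (rule sum.cong) (simp_all add: op_inverse_eq_powr tuple_pos_def)
  then have "harmonic_mean n w A = op_inverse (power_sum (- 1))"
    by (simp only: harmonic_mean_def)
  also have "\<dots> = op_powr (power_sum (- 1)) (- 1)"
    by (rule op_inverse_eq_powr[OF pos_def_power_sum])
  finally show ?thesis
    by (simp add: quasi_mean_def quasi_mean_nonzero_eq)
qed

lemma quasi_mean_near_mono:
  assumes "0 \<le> p" "p \<le> q"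
  shows "quasi_mean p n w A \<preceq> quasi_mean q n w A"
    and "quasi_mean (- q) n w A \<preceq> quasi_mean (- p) n w A"
proof -
  have refl: "log_euclidean_mean n w A \<preceq> log_euclidean_mean n w A"
    by (intro quadratic_form_le_imp_near_le pos_def_log_euclidean_mean order_refl)
  have nz: "quasi_mean r n w A = quasi_mean_nonzero r n w A" if "r \<noteq> 0" for r
    using that by (simp add: quasi_mean_def)
  have "p = 0 \<and> q = 0 \<or> p = 0 \<and> 0 < q \<or> 0 < p" using assms by linarith
  then show "quasi_mean p n w A \<preceq> quasi_mean q n w A"
    "quasi_mean (- q) n w A \<preceq> quasi_mean (- p) n w A"
    using assms by (auto simp: quasi_mean_0 nz refl log_euclidean_near quasi_mean_nonzero_near_mono)
qed

end

theorem theorem4p4: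
  fixes n :: nat
    and w :: "nat \<Rightarrow> real"
    and A :: "nat \<Rightarrow> ('a::complex_hilbert \<Rightarrow>\<^sub>L 'a)"
    and p q :: real
  assumes "\<And>j. j \<in> {1..n} \<Longrightarrow> A j \<in> \<P>"
    and "w \<in> \<Delta> n"
    and "0 \<le> p" and "p \<le> q" and "q \<le> 1"
  shows "harmonic_mean n w A \<preceq> quasi_mean (- q) n w A
    \<and> quasi_mean (- q) n w A \<preceq> quasi_mean (- p) n w A
    \<and> quasi_mean (- p) n w A \<preceq> log_euclidean_mean n w A
    \<and> log_euclidean_mean n w A \<preceq> quasi_mean p n w A
    \<and> quasi_mean p n w A \<preceq> quasi_mean q n w A
    \<and> quasi_mean q n w A \<preceq> arithmetic_mean n w A"
proof -
  have A: "\<forall>j\<in>{1..n}. A j \<in> \<P>" using assms(1) by blast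
  note mono = quasi_mean_near_mono[OF A assms(2)]
  have "0 \<le> q" using assms(3,4) by simp
  show ?thesis
    using mono[OF \<open>0 \<le> q\<close> \<open>q \<le> 1\<close>] mono[OF assms(3,4)] mono[OF order_refl assms(3)]
    by (simp add: harmonic_mean_eq[OF A assms(2)] arithmetic_mean_eq[OF A assms(2)]
        quasi_mean_0[OF A assms(2)])
qed

end
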